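(* The following statements hold. (i) For every $g\in\overline{\mathcal{G}_+}$, $\mathcal{GP}_g$ is a convex sub-cone of $\mathcal{GP}$. (ii) For $g_1,g_2\in\overline{\mathcal{G}_+}$, $$\mathcal{GP}_{g_2}=\left(\frac{g_2}{g_1}\right)\mathcal{GP}_{g_1}\left(\frac{g_2}{g_1}\right)^{\#}.$$ (iii) Let $g_1,g_2\in\overline{\mathcal{G}_+}$ be such that $g_2$ is not of the form $cg_1$ for any constant $c$. Then $\mathcal{GP}_{g_1}\cap\mathcal{GP}_{g_2}=\{0\}$. (iv) $\mathcal{GP}=\bigcup_{g\in\overline{\mathcal{G}_+}}\mathcal{GP}_g$. (v) For every $g\in\overline{\mathcal{G}_+}$, $(\mathcal{GP}_g)^{-1}=\mathcal{GP}_{(g^{\#})^{-1}}$, where the zero function is disregarded on both sides.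
   Context: All functions are scalar rational functions of a complex variable $s$ with complex coefficients. $\mathbb{C}_+=\{\operatorname{Re}s>0\}$, $\mathbb{C}_-=\{\operatorname{Re}s<0\}$. For a rational function $g$, $g^{\#}(s):=(g(-s^* ))^*$, where $^*$ is complex conjugation. $\mathcal{P}$ (positive functions) is the set of rational functions analytic in $\mathbb{C}_+$ with $\operatorname{Re}p(s)\ge0$ for all $s\in\mathbb{C}_+$. $\mathcal{GP}$ (generalized positive functions) is the set of rational functions $\psi$ with $\operatorname{Re}\psi(s)\ge0$ for all $s\in i\mathbb{R}$ which are not poles of $\psi$. The zero function belongs to both sets. $\overline{\mathcal{G}_+}$ is the set of nonzero rational functions $g$ such that both $g$ and $g^{-1}$ are analytic in $\mathbb{C}_-$ (equivalently, all finite poles and zeroes of $g$ lie in $\mathbb{C}_+\cup i\mathbb{R}$). For a nonzero rational function $g$, $\mathcal{GP}_g:=\{g\,p\,g^{\#}:p\in\mathcal{P}\}$. For a rational function $h$ and a set $S$ of rational functions, $h\,S\,h^{\#}:=\{h\psi h^{\#}:\psi\in S\}$, and $S^{-1}:=\{\psi^{-1}:\psi\in S,\ \psi\not\equiv0\}$. *)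

theory Defs
  imports
    "HOL-Complex_Analysis.Complex_Analysis"
    "HOL-Computational_Algebra.Computational_Algebra"
    "HOL-Computational_Algebra.Field_as_Ring"
begin

text \<open>These instances give meaning to the library predicate \<^const>\<open>convex_cone\<close>
  on sets of rational functions.\<close>

instantiation poly :: ("{real_algebra_1, comm_ring_1}") real_algebra_1
begin

definition scaleR_poly :: "real \<Rightarrow> 'a poly \<Rightarrow> 'a poly"
  where "scaleR_poly r p = smult (of_real r) p"

instance
  by standard (simp_all add: scaleR_poly_def smult_add_left smult_add_right)

end

instantiation fract :: ("{real_algebra_1, idom}") real_vector
begin

definition scaleR_fract :: "real \<Rightarrow> 'a fract \<Rightarrow> 'a fract"
  where "scaleR_fract r f = to_fract (of_real r) * f"

instance
  by standard (simp_all add: scaleR_fract_def ring_distribs)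

end


type_synonym ratfun = "complex poly fract"

definition ratfun_const :: "complex \<Rightarrow> ratfun"
  where "ratfun_const c = to_fract [:c:]"

text \<open>Evaluation uses the reduced representation, so that removable singularities are
  removed; the value at a pole is \<open>0\<close> because of division by zero.\<close>

definition ratfun_eval :: "ratfun \<Rightarrow> complex \<Rightarrow> complex"
  where "ratfun_eval f s = poly (fst (quot_of_fract f)) s / poly (snd (quot_of_fract f)) s"

text \<open>The coefficients of \<open>(p(-s\<^sup>*))\<^sup>*\<close> are those of \<open>p\<close>, conjugated, with alternating sign.\<close>

definition poly_sharp :: "complex poly \<Rightarrow> complex poly"
  where "poly_sharp p = pcompose (map_poly cnj p) [:0, -1:]"

definition ratfun_sharp :: "ratfun \<Rightarrow> ratfun"
  where "ratfun_sharp f =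
    Fraction_Field.Fract (poly_sharp (fst (quot_of_fract f))) (poly_sharp (snd (quot_of_fract f)))"


definition positive_funs :: "ratfun set" where
  "positive_funs = {p. ratfun_eval p analytic_on {s. Re s > 0} \<and>
     (\<forall>s. Re s > 0 \<longrightarrow> Re (ratfun_eval p s) \<ge> 0)}"

definition gen_positive_funs :: "ratfun set" where
  "gen_positive_funs =
     {\<psi>. \<forall>s. Re s = 0 \<longrightarrow> \<not> is_pole (ratfun_eval \<psi>) s \<longrightarrow> Re (ratfun_eval \<psi> s) \<ge> 0}"

definition Gplus_closure :: "ratfun set" where
  "Gplus_closure = {g. g \<noteq> 0 \<and> ratfun_eval g analytic_on {s. Re s < 0} \<and>
     ratfun_eval (inverse g) analytic_on {s. Re s < 0}}"

definition ratfun_congr :: "ratfun \<Rightarrow> ratfun set \<Rightarrow> ratfun set"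
  where "ratfun_congr h S = {h * \<psi> * ratfun_sharp h | \<psi>. \<psi> \<in> S}"

definition GP_of :: "ratfun \<Rightarrow> ratfun set"
  where "GP_of g = {g * p * ratfun_sharp g | p. p \<in> positive_funs}"

definition ratfun_set_inverse :: "ratfun set \<Rightarrow> ratfun set"
  where "ratfun_set_inverse S = {inverse \<psi> | \<psi>. \<psi> \<in> S \<and> \<psi> \<noteq> 0}"


lemma scaleR_ratfun: "r *\<^sub>R (f :: ratfun) = ratfun_const (of_real r) * f"
proof -
  have "(of_real r :: complex poly) = [:of_real r:]"
    by (simp add: of_real_def scaleR_poly_def)
  then show ?thesis
    by (simp add: scaleR_fract_def ratfun_const_def)
qed

lemma poly_poly_sharp: "poly (poly_sharp p) s = cnj (poly p (- cnj s))"
  by (induction p) (simp_all add: poly_sharp_def map_poly_pCons pcompose_pCons algebra_simps)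

lemma poly_sharp_eq_0_iff [simp]: "poly_sharp p = 0 \<longleftrightarrow> p = 0"
  by (simp add: poly_sharp_def map_poly_eq_0_iff pcompose_eq_0_iff)

lemma ratfun_no_common_zero:
  "poly (fst (quot_of_fract (f :: ratfun))) s \<noteq> 0 \<or> poly (snd (quot_of_fract f)) s \<noteq> 0"
  using coprime_quot_of_fract[of f] coprime_poly_0 by blast

lemma ratfun_eval_Fract:
  assumes "poly b s \<noteq> 0"
  shows "ratfun_eval (Fraction_Field.Fract a b) s = poly a s / poly b s"
proof -
  define f where "f = Fraction_Field.Fract a b"
  define u v where "u = fst (quot_of_fract f)" and "v = snd (quot_of_fract f)"
  have "b \<noteq> 0" using assms by auto
  have "Fraction_Field.Fract u v = Fraction_Field.Fract a b"
    unfolding u_def v_def by (simp add: f_def)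
  moreover have "v \<noteq> 0" by (simp add: v_def)
  ultimately have "u * b = a * v"
    using \<open>b \<noteq> 0\<close> by (simp add: eq_fract)
  then have eq: "poly u s * poly b s = poly a s * poly v s"
    by (metis poly_mult)
  moreover have "poly v s \<noteq> 0"
    using eq assms ratfun_no_common_zero[of f s] by (auto simp: u_def v_def)
  ultimately show ?thesis
    using assms by (simp add: ratfun_eval_def f_def u_def v_def field_simps)
qed

lemma is_pole_ratfun_eval_iff:
  "is_pole (ratfun_eval f) s \<longleftrightarrow> poly (snd (quot_of_fract f)) s = 0"
proof
  let ?u = "fst (quot_of_fract f)" and ?v = "snd (quot_of_fract f)"
  have lim: "poly ?u \<midarrow>s\<rightarrow> poly ?u s" "poly ?v \<midarrow>s\<rightarrow> poly ?v s"
    by (auto intro!: tendsto_intros)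
  show "poly ?v s = 0" if "is_pole (ratfun_eval f) s"
  proof (rule ccontr)
    assume "poly ?v s \<noteq> 0"
    then have "(\<lambda>z. poly ?u z / poly ?v z) \<midarrow>s\<rightarrow> poly ?u s / poly ?v s"
      by (intro tendsto_divide lim)
    then show False
      using that unfolding is_pole_def ratfun_eval_def
      by (metis not_tendsto_and_filterlim_at_infinity trivial_limit_at)
  qed
  assume v: "poly ?v s = 0"
  then have u: "poly ?u s \<noteq> 0" using ratfun_no_common_zero by blast
  have "finite {z. poly ?v z = 0}" by (simp add: poly_roots_finite)
  then have "\<forall>\<^sub>F z in at s. z \<notin> {z. poly ?v z = 0}"
    by (metis eventually_at_topological islimpt_finite islimpt_iff_eventually)
  then have "filterlim (poly ?v) (at 0) (at s)"
    using lim(2) v by (intro filterlim_atI) (auto elim: eventually_mono)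
  then show "is_pole (ratfun_eval f) s"
    unfolding is_pole_def ratfun_eval_def using lim(1) u
    by (intro filterlim_divide_at_infinity)
qed

lemma ratfun_eval_sharp: "ratfun_eval (ratfun_sharp f) s = cnj (ratfun_eval f (- cnj s))"
proof (cases "poly (snd (quot_of_fract f)) (- cnj s) = 0")
  case False
  then show ?thesis
    unfolding ratfun_sharp_def
    by (subst ratfun_eval_Fract) (simp_all add: poly_poly_sharp ratfun_eval_def)
next
  case True
  define h where "h = ratfun_sharp f"
  define u v where "u = fst (quot_of_fract f)" and "v = snd (quot_of_fract f)"
  define a b where "a = fst (quot_of_fract h)" and "b = snd (quot_of_fract h)"
  have "Fraction_Field.Fract a b = Fraction_Field.Fract (poly_sharp u) (poly_sharp v)"
    unfolding a_def b_def u_def v_def by (simp add: h_def ratfun_sharp_def)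
  moreover have "b \<noteq> 0" "poly_sharp v \<noteq> 0" by (simp_all add: b_def v_def)
  ultimately have "a * poly_sharp v = poly_sharp u * b"
    by (simp add: eq_fract)
  then have "poly a s * cnj (poly v (- cnj s)) = cnj (poly u (- cnj s)) * poly b s"
    by (metis poly_mult poly_poly_sharp)
  moreover have "poly u (- cnj s) \<noteq> 0"
    using True ratfun_no_common_zero u_def by blast
  ultimately have "poly b s = 0"
    using True by (simp add: v_def)
  then show ?thesis
    using True by (simp add: ratfun_eval_def b_def h_def)
qed

end

theory Submission
  imports Defs
begin

text \<open>
  On the imaginary axis \<open>g\<^sup>#\<close> is the conjugate of \<open>g\<close>, so \<open>g p g\<^sup>#\<close> equals \<open>|g|\<^sup>2 p\<close> there.

  For the factorization of a generalized positive \<open>u / v\<close>, factors \<open>(s - a)(s - a)\<^sup>#\<close> with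
  \<open>Re a \<ge> 0\<close> are moved out, which reflects zeros and poles in the right half plane to the left one
  and leaves on the imaginary axis only simple ones with a positive coefficient (a zero with a
  negative coefficient becomes a pole with a positive one). What remains is a positive function: the
  \<open>z\<close> with \<open>Re z > 0\<close> for which \<open>u + z v\<close> has a root in the right half plane form a set that is
  both open (open mapping theorem) and closed (no root can escape through the imaginary axis, nor
  to infinity if \<open>deg v \<le> deg u\<close>) in the right half plane, and it misses the small positive \<open>z\<close>,
  because the imaginary roots of \<open>u\<close> move to the left as \<open>z\<close> leaves \<open>0\<close>.

  If \<open>p\<^sub>1 = f p\<^sub>2 f\<^sup>#\<close> with positive \<open>p\<^sub>1, p\<^sub>2\<close>, a zero of \<open>f\<close> in the right half plane would be a
  zero of \<open>p\<^sub>1\<close> or a pole of \<open>p\<^sub>2\<close>. At an imaginary zero of \<open>f\<close>, \<open>p\<^sub>1\<close> must have a simple zero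
  and \<open>p\<^sub>2\<close> a simple pole, both with positive coefficients, whereas \<open>f f\<^sup>#\<close> behaves like
  \<open>-(s - a)\<^sup>2\<close>; the signs do not match. Hence \<open>f\<close> is constant.
\<close>

subsection \<open>Positivity of quotients of polynomials\<close>

abbreviation num :: "ratfun \<Rightarrow> complex poly" where "num f \<equiv> fst (quot_of_fract f)"
abbreviation den :: "ratfun \<Rightarrow> complex poly" where "den f \<equiv> snd (quot_of_fract f)"

lemma Fract_num_mult:
  assumes "f = Fraction_Field.Fract a b" "b \<noteq> 0"
  shows "num f * b = a * den f"
proof -
  have "Fraction_Field.Fract (num f) (den f) = Fraction_Field.Fract a b"
    using assms by simp
  then show ?thesis
    using assms(2) by (subst (asm) eq_fract(1)) simp_all
qed

lemma ratfun_cases [case_names Fract]: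
  obtains a b where "f = Fraction_Field.Fract a b" "b \<noteq> 0"
    "\<And>s. poly a s \<noteq> 0 \<or> poly b s \<noteq> (0::complex)"
proof
  show "f = Fraction_Field.Fract (num f) (den f)" by simp
  show "den f \<noteq> 0" by simp
qed (rule ratfun_no_common_zero)

text \<open>A zero of the reduced denominator is a genuine pole, because numerator and denominator
  have no common zero; analyticity gives continuity, which excludes poles.\<close>

lemma ratfun_eval_analytic_on_iff:
  assumes "open S"
  shows "ratfun_eval f analytic_on S \<longleftrightarrow> (\<forall>s\<in>S. poly (den f) s \<noteq> 0)"
proof
  assume an: "ratfun_eval f analytic_on S"
  show "\<forall>s\<in>S. poly (den f) s \<noteq> 0"
  proof
    fix s assume "s \<in> S"
    then have "isCont (ratfun_eval f) s"
      using an analytic_at_imp_isCont analytic_on_analytic_at by blast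
    then have "\<not> is_pole (ratfun_eval f) s"
      unfolding is_pole_def isCont_def
      by (metis not_tendsto_and_filterlim_at_infinity trivial_limit_at)
    then show "poly (den f) s \<noteq> 0"
      by (simp add: is_pole_ratfun_eval_iff)
  qed
next
  assume "\<forall>s\<in>S. poly (den f) s \<noteq> 0"
  then have "ratfun_eval f holomorphic_on S"
    unfolding ratfun_eval_def by (auto intro!: holomorphic_intros)
  then show "ratfun_eval f analytic_on S"
    using assms by (simp add: analytic_on_open)
qed

lemma Re_divide_nonneg_iff:
  assumes "z \<noteq> 0"
  shows "Re (w / z) \<ge> 0 \<longleftrightarrow> Re (w * cnj z) \<ge> 0"
proof -
  have "Re (w / z) = Re (w * cnj z) / (cmod z)\<^sup>2"
    by (subst complex_div_cnj) (simp add: Re_divide_of_real flip: of_real_power)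
  then show ?thesis
    using assms by (simp add: zero_le_divide_iff)
qed

lemma Re_mult_of_real [simp]:
  "Re (of_real c * z) = c * Re z" "Re (z * of_real c) = c * Re z"
  by simp_all

text \<open>The hypothesis is \<open>x / y = w / c\<close> cleared of denominators. The identity
  carries the sign condition from one representation of a fraction to another, and it stays valid
  where a denominator vanishes.\<close>

lemma Re_mult_cnj_shift:
  assumes "x * c = w * (y::complex)"
  shows "(cmod c)\<^sup>2 * Re (x * cnj y) = (cmod y)\<^sup>2 * Re (w * cnj c)"
proof -
  have "complex_of_real ((cmod c)\<^sup>2) * (x * cnj y) = (x * c) * cnj c * cnj y"
    unfolding complex_norm_square by (simp only: mult_ac)
  also have "\<dots> = complex_of_real ((cmod y)\<^sup>2) * (w * cnj c)"
    unfolding complex_norm_square assms by (simp only: mult_ac)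
  finally have "Re (complex_of_real ((cmod c)\<^sup>2) * (x * cnj y)) =
    Re (complex_of_real ((cmod y)\<^sup>2) * (w * cnj c))" by simp
  then show ?thesis by simp
qed

section \<open>The sign condition as a polynomial inequality\<close>

text \<open>This is \<open>Re (u / v) \<ge> 0\<close> multiplied by the squared modulus of
  \<open>v\<close>. It is trivial at zeros of \<open>v\<close>, so poles need no exception; it is
  symmetric in \<open>u\<close> and \<open>v\<close> and survives limits.\<close>

definition pos_pair_at :: "complex poly \<Rightarrow> complex poly \<Rightarrow> complex \<Rightarrow> bool" where
  "pos_pair_at u v s \<longleftrightarrow> Re (poly u s * cnj (poly v s)) \<ge> 0"

lemma pos_pair_at_commute: "pos_pair_at u v s \<longleftrightarrow> pos_pair_at v u s"
  by (simp add: pos_pair_at_def mult.commute)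

lemma pos_pair_at_limit:
  assumes "\<forall>n. pos_pair_at u v (f n)" "f \<longlonglongrightarrow> s"
  shows "pos_pair_at u v s"
proof -
  have "(\<lambda>n. Re (poly u (f n) * cnj (poly v (f n)))) \<longlonglongrightarrow> Re (poly u s * cnj (poly v s))"
    by (intro tendsto_intros assms(2))
  then show ?thesis
    using assms(1) unfolding pos_pair_at_def by (intro LIMSEQ_le_const) auto
qed

text \<open>The points \<open>s + \<i> / (n + 1)\<close> are distinct, so only finitely many lie in
  \<open>F\<close>; dropping these leaves a sequence on the axis to which continuity
  applies.\<close>

lemma pos_pair_at_cofinite:
  assumes "finite F" "\<And>s. Re s = 0 \<Longrightarrow> s \<notin> F \<Longrightarrow> pos_pair_at u v s" "Re s = 0"
  shows "pos_pair_at u v s"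
proof -
  define g where "g n = s + \<i> * of_real (inverse (of_nat (Suc n)))" for n
  have "inj g"
    by (auto simp: inj_def g_def)
  then have "finite (g -` F)"
    using assms(1) by (simp add: finite_vimageI)
  from finite_nat_bounded[OF this] obtain N where N: "g -` F \<subseteq> {..<N}" ..
  have "g \<longlonglongrightarrow> s + \<i> * of_real 0"
    unfolding g_def by (intro tendsto_intros LIMSEQ_inverse_real_of_nat)
  then have "(\<lambda>n. g (n + N)) \<longlonglongrightarrow> s"
    by (simp add: LIMSEQ_ignore_initial_segment)
  moreover have "\<forall>n. pos_pair_at u v (g (n + N))"
  proof
    fix n
    have "g (n + N) \<notin> F" using N by auto
    then show "pos_pair_at u v (g (n + N))"
      using assms(2,3) by (simp add: g_def)
  qed
  ultimately show ?thesis by (rule pos_pair_at_limit[rotated])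
qed

lemma pos_pair_at_closure:
  assumes "\<And>s. Re s > 0 \<Longrightarrow> pos_pair_at u v s" "Re s \<ge> 0"
  shows "pos_pair_at u v s"
proof -
  define g where "g n = s + of_real (inverse (of_nat (Suc n)))" for n
  have "g \<longlonglongrightarrow> s + of_real 0"
    unfolding g_def by (intro tendsto_intros LIMSEQ_inverse_real_of_nat)
  moreover have "Re (g n) > 0" for n
    using assms(2) unfolding g_def by (simp add: add_nonneg_pos del: of_nat_Suc)
  ultimately show ?thesis
    using assms(1) by (intro pos_pair_at_limit[of u v g]) auto
qed

lemma gen_positive_iff_num_den:
  "\<psi> \<in> gen_positive_funs \<longleftrightarrow> (\<forall>s. Re s = 0 \<longrightarrow> pos_pair_at (num \<psi>) (den \<psi>) s)"
proof -
  have "poly (den \<psi>) s = 0 \<or> Re (ratfun_eval \<psi> s) \<ge> 0 \<longleftrightarrow> pos_pair_at (num \<psi>) (den \<psi>) s" for s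
  proof (cases "poly (den \<psi>) s = 0")
    case False
    then show ?thesis
      unfolding ratfun_eval_def pos_pair_at_def using Re_divide_nonneg_iff by blast
  qed (simp add: pos_pair_at_def)
  then show ?thesis
    unfolding gen_positive_funs_def is_pole_ratfun_eval_iff mem_Collect_eq by blast
qed

text \<open>Makes the criterion available for unreduced fractions. A zero of the reduced denominator
  is a zero of \<open>b\<close>, which settles one direction; in the other, the finitely many zeros
  of \<open>b\<close> are filled in by continuity along the axis.\<close>

lemma gen_positive_Fract_iff:
  assumes "b \<noteq> 0"
  shows "Fraction_Field.Fract a b \<in> gen_positive_funs \<longleftrightarrow> (\<forall>s. Re s = 0 \<longrightarrow> pos_pair_at a b s)"
    (is "?f \<in> _ \<longleftrightarrow> _")
proof -
  have eq: "poly (num ?f) s * poly b s = poly a s * poly (den ?f) s" for s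
    using Fract_num_mult[OF refl assms, of a] by (metis poly_mult)
  have shift: "(cmod (poly b s))\<^sup>2 * Re (poly (num ?f) s * cnj (poly (den ?f) s)) =
      (cmod (poly (den ?f) s))\<^sup>2 * Re (poly a s * cnj (poly b s))" for s
    by (intro Re_mult_cnj_shift eq)
  have "pos_pair_at a b s" if "pos_pair_at (num ?f) (den ?f) s" for s
  proof (cases "poly (den ?f) s = 0")
    case True
    then have "poly b s = 0"
      using eq[of s] ratfun_no_common_zero[of ?f s] by auto
    then show ?thesis by (simp add: pos_pair_at_def)
  next
    case False
    have "(cmod (poly (den ?f) s))\<^sup>2 * Re (poly a s * cnj (poly b s)) \<ge> 0"
      unfolding shift[symmetric] using that unfolding pos_pair_at_def by (intro mult_nonneg_nonneg) auto
    then show ?thesis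
      using False by (simp add: pos_pair_at_def zero_le_mult_iff)
  qed
  moreover have "pos_pair_at (num ?f) (den ?f) s" if "\<forall>s. Re s = 0 \<longrightarrow> pos_pair_at a b s" "Re s = 0" for s
  proof (rule pos_pair_at_cofinite)
    show "finite {s. poly b s = 0}" using assms by (rule poly_roots_finite)
    fix t assume t: "Re t = 0" "t \<notin> {s. poly b s = 0}"
    have "(cmod (poly b t))\<^sup>2 * Re (poly (num ?f) t * cnj (poly (den ?f) t)) \<ge> 0"
      unfolding shift using that t unfolding pos_pair_at_def by (intro mult_nonneg_nonneg) auto
    then show "pos_pair_at (num ?f) (den ?f) t"
      using t by (simp add: pos_pair_at_def zero_le_mult_iff)
  qed fact
  ultimately show ?thesis
    unfolding gen_positive_iff_num_den by blast
qed

lemma positive_iff_num_den: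
  "p \<in> positive_funs \<longleftrightarrow>
    (\<forall>s. Re s > 0 \<longrightarrow> poly (den p) s \<noteq> 0 \<and> pos_pair_at (num p) (den p) s)"
proof -
  have "Re (ratfun_eval p s) \<ge> 0 \<longleftrightarrow> pos_pair_at (num p) (den p) s" if "poly (den p) s \<noteq> 0" for s
    unfolding ratfun_eval_def pos_pair_at_def using that by (rule Re_divide_nonneg_iff)
  then show ?thesis
    unfolding positive_funs_def mem_Collect_eq ratfun_eval_analytic_on_iff[OF open_halfspace_Re_gt] by blast
qed

lemma positive_Fract:
  assumes "\<And>s. Re s > 0 \<Longrightarrow> poly b s \<noteq> 0" "\<And>s. Re s > 0 \<Longrightarrow> pos_pair_at a b s"
  shows "Fraction_Field.Fract a b \<in> positive_funs"
proof -
  let ?f = "Fraction_Field.Fract a b"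
  have "b \<noteq> 0" using assms(1)[of 1] by auto
  then have eq: "poly (num ?f) s * poly b s = poly a s * poly (den ?f) s" for s
    using Fract_num_mult[OF refl, of b a] by (metis poly_mult)
  have "poly (den ?f) s \<noteq> 0" if "Re s > 0" for s
    using eq[of s] assms(1)[OF that] ratfun_no_common_zero[of ?f s] by auto
  moreover have "Re (ratfun_eval ?f s) \<ge> 0" if "Re s > 0" for s
    using assms[OF that] by (simp add: ratfun_eval_Fract Re_divide_nonneg_iff pos_pair_at_def)
  ultimately show ?thesis
    unfolding positive_funs_def by (simp add: ratfun_eval_analytic_on_iff[OF open_halfspace_Re_gt])
qed

lemma positive_funsE:
  assumes "p \<in> positive_funs"
  obtains u v where "p = Fraction_Field.Fract u v" "v \<noteq> 0"
    "\<And>s. poly u s \<noteq> 0 \<or> poly v s \<noteq> 0"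
    "\<And>s. Re s > 0 \<Longrightarrow> poly v s \<noteq> 0" "\<And>s. Re s \<ge> 0 \<Longrightarrow> pos_pair_at u v s"
proof
  show "p = Fraction_Field.Fract (num p) (den p)" by simp
  show "den p \<noteq> 0" by simp
  show "\<And>s. poly (num p) s \<noteq> 0 \<or> poly (den p) s \<noteq> 0" by (rule ratfun_no_common_zero)
  show "\<And>s. Re s > 0 \<Longrightarrow> poly (den p) s \<noteq> 0"
    using assms positive_iff_num_den by blast
  show "\<And>s. Re s \<ge> 0 \<Longrightarrow> pos_pair_at (num p) (den p) s"
    using assms positive_iff_num_den by (blast intro: pos_pair_at_closure)
qed

lemma zero_in_positive_funs: "0 \<in> positive_funs"
  unfolding Zero_fract_def by (rule positive_Fract) (simp_all add: pos_pair_at_def)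

lemma positive_funs_add:
  assumes "p \<in> positive_funs" "q \<in> positive_funs"
  shows "p + q \<in> positive_funs"
proof -
  obtain u v where p: "p = Fraction_Field.Fract u v" "v \<noteq> 0"
    "\<And>s. Re s > 0 \<Longrightarrow> poly v s \<noteq> 0" "\<And>s. Re s \<ge> 0 \<Longrightarrow> pos_pair_at u v s"
    using assms(1) by (auto elim: positive_funsE)
  obtain x y where q: "q = Fraction_Field.Fract x y" "y \<noteq> 0"
    "\<And>s. Re s > 0 \<Longrightarrow> poly y s \<noteq> 0" "\<And>s. Re s \<ge> 0 \<Longrightarrow> pos_pair_at x y s"
    using assms(2) by (auto elim: positive_funsE)
  have "p + q = Fraction_Field.Fract (u * y + x * v) (v * y)"
    using p q by simp
  moreover have "\<dots> \<in> positive_funs"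
  proof (rule positive_Fract)
    fix s :: complex assume s: "Re s > 0"
    show nz: "poly (v * y) s \<noteq> 0" using p(3) q(3) s by simp
    have "Re (poly u s / poly v s) \<ge> 0" "Re (poly x s / poly y s) \<ge> 0"
      using p(3,4)[of s] q(3,4)[of s] s by (simp_all add: Re_divide_nonneg_iff pos_pair_at_def)
    then have "Re (poly u s / poly v s + poly x s / poly y s) \<ge> 0" by simp
    also have "poly u s / poly v s + poly x s / poly y s = poly (u * y + x * v) s / poly (v * y) s"
      using p(3)[OF s] q(3)[OF s] by (simp add: add_frac_eq)
    finally show "pos_pair_at (u * y + x * v) (v * y) s"
      unfolding Re_divide_nonneg_iff[OF nz] pos_pair_at_def .
  qed
  ultimately show ?thesis by simp
qed

lemma positive_funs_scaleR:
  assumes "p \<in> positive_funs" "c \<ge> 0"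
  shows "ratfun_const (of_real c) * p \<in> positive_funs"
proof -
  obtain u v where p: "p = Fraction_Field.Fract u v" "v \<noteq> 0"
    "\<And>s. Re s > 0 \<Longrightarrow> poly v s \<noteq> 0" "\<And>s. Re s \<ge> 0 \<Longrightarrow> pos_pair_at u v s"
    using assms(1) by (auto elim: positive_funsE)
  have "ratfun_const (of_real c) * p = Fraction_Field.Fract ([:of_real c:] * u) v"
    using p by (simp add: ratfun_const_def to_fract_def)
  moreover have "\<dots> \<in> positive_funs"
  proof (rule positive_Fract)
    show "pos_pair_at ([:of_real c:] * u) v s" if "Re s > 0" for s
      using p(4)[of s] that assms(2)
      by (simp add: pos_pair_at_def mult.assoc flip: right_diff_distrib)
  qed (rule p(3))
  ultimately show ?thesis by simp
qed

subsection \<open>Para-conjugation and the classes \<open>GP\<^sub>g\<close>\<close>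

lemma poly_sharp_mult: "poly_sharp (p * q) = poly_sharp p * poly_sharp q"
  by (simp add: poly_eq_poly_eq_iff[symmetric] fun_eq_iff poly_poly_sharp)

lemma poly_sharp_sharp [simp]: "poly_sharp (poly_sharp p) = p"
  by (simp add: poly_eq_poly_eq_iff[symmetric] fun_eq_iff poly_poly_sharp)

lemma poly_sharp_linear: "poly_sharp [:- a, 1:] = [:- cnj a, -1:]"
  by (simp add: poly_eq_poly_eq_iff[symmetric] fun_eq_iff poly_poly_sharp)

lemma ratfun_sharp_Fract:
  assumes "b \<noteq> 0"
  shows "ratfun_sharp (Fraction_Field.Fract a b) = Fraction_Field.Fract (poly_sharp a) (poly_sharp b)"
proof -
  let ?f = "Fraction_Field.Fract a b"
  have "poly_sharp (num ?f) * poly_sharp b = poly_sharp a * poly_sharp (den ?f)"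
    using Fract_num_mult[OF refl assms, of a] by (metis poly_sharp_mult)
  then show ?thesis
    unfolding ratfun_sharp_def using assms by (simp add: eq_fract)
qed

lemma ratfun_sharp_mult: "ratfun_sharp (f * g) = ratfun_sharp f * ratfun_sharp g"
proof -
  obtain a b where f: "f = Fraction_Field.Fract a b" "b \<noteq> 0" by (rule ratfun_cases)
  obtain c d where g: "g = Fraction_Field.Fract c d" "d \<noteq> 0" by (rule ratfun_cases)
  show ?thesis using f g by (simp add: ratfun_sharp_Fract poly_sharp_mult)
qed

lemma ratfun_sharp_inverse: "ratfun_sharp (inverse f) = inverse (ratfun_sharp f)"
proof -
  obtain a b where f: "f = Fraction_Field.Fract a b" "b \<noteq> 0" by (rule ratfun_cases)
  show ?thesis
  proof (cases "a = 0")
    case True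
    then have "f = 0" using f by (simp add: eq_fract Zero_fract_def)
    moreover have "ratfun_sharp 0 = 0"
      unfolding Zero_fract_def by (simp add: ratfun_sharp_Fract eq_fract)
    ultimately show ?thesis by simp
  qed (simp add: f ratfun_sharp_Fract)
qed

lemma ratfun_sharp_divide: "ratfun_sharp (f / g) = ratfun_sharp f / ratfun_sharp g"
  by (simp add: divide_inverse ratfun_sharp_mult ratfun_sharp_inverse)

lemma ratfun_sharp_sharp [simp]: "ratfun_sharp (ratfun_sharp f) = f"
proof -
  obtain a b where f: "f = Fraction_Field.Fract a b" "b \<noteq> 0" by (rule ratfun_cases)
  show ?thesis using f by (simp add: ratfun_sharp_Fract)
qed

lemma ratfun_sharp_eq_0_iff [simp]: "ratfun_sharp f = 0 \<longleftrightarrow> f = 0"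
proof -
  obtain a b where f: "f = Fraction_Field.Fract a b" "b \<noteq> 0" by (rule ratfun_cases)
  show ?thesis using f by (simp add: ratfun_sharp_Fract eq_fract Zero_fract_def)
qed

section \<open>Functions without zeros and poles in the left half plane\<close>

text \<open>Cross-multiplying the reduced fractions of \<open>g\<close> and
  \<open>inverse g\<close>, neither of which has a common zero, shows that the denominator of
  \<open>inverse g\<close> vanishes exactly where the numerator of \<open>g\<close> does.\<close>

lemma Gplus_closure_iff_num_den:
  "g \<in> Gplus_closure \<longleftrightarrow> g \<noteq> 0 \<and> (\<forall>s. Re s < 0 \<longrightarrow> poly (num g) s \<noteq> 0 \<and> poly (den g) s \<noteq> 0)"
proof -
  have "poly (den (inverse g)) s = 0 \<longleftrightarrow> poly (num g) s = 0" if "g \<noteq> 0" for s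
  proof -
    have "inverse g = Fraction_Field.Fract (den g) (num g)"
      by (metis Fract_quot_of_fract inverse_fract)
    then have "num (inverse g) * num g = den g * den (inverse g)"
      using that by (intro Fract_num_mult) auto
    then have "poly (num (inverse g)) s * poly (num g) s = poly (den g) s * poly (den (inverse g)) s"
      by (metis poly_mult)
    then show ?thesis
      using ratfun_no_common_zero[of g s] ratfun_no_common_zero[of "inverse g" s] by auto
  qed
  then show ?thesis
    unfolding Gplus_closure_def mem_Collect_eq ratfun_eval_analytic_on_iff[OF open_halfspace_Re_lt] by blast
qed

lemma Fract_in_Gplus_closure:
  assumes "\<And>s. Re s < 0 \<Longrightarrow> poly a s \<noteq> 0" "\<And>s. Re s < 0 \<Longrightarrow> poly b s \<noteq> 0"
  shows "Fraction_Field.Fract a b \<in> Gplus_closure"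
proof -
  let ?f = "Fraction_Field.Fract a b"
  have nz: "a \<noteq> 0" "b \<noteq> 0" using assms(1,2)[of "-1"] by auto
  have eq: "poly (num ?f) s * poly b s = poly a s * poly (den ?f) s" for s
    using Fract_num_mult[OF refl nz(2), of a] by (metis poly_mult)
  have "?f \<noteq> 0" using nz by (simp add: Zero_fract_def eq_fract)
  then show ?thesis
    unfolding Gplus_closure_iff_num_den
  proof (intro conjI allI impI)
    fix s assume s: "Re s < 0"
    have "poly a s \<noteq> 0" "poly b s \<noteq> 0" using assms s by simp_all
    then show "poly (num ?f) s \<noteq> 0" "poly (den ?f) s \<noteq> 0"
      using eq[of s] ratfun_no_common_zero[of ?f s] by auto
  qed
qed

lemma Gplus_closureE:
  assumes "g \<in> Gplus_closure"
  obtains a b where "g = Fraction_Field.Fract a b" "a \<noteq> 0" "b \<noteq> 0"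
    "\<And>s. poly a s \<noteq> 0 \<or> poly b s \<noteq> 0"
    "\<And>s. Re s < 0 \<Longrightarrow> poly a s \<noteq> 0" "\<And>s. Re s < 0 \<Longrightarrow> poly b s \<noteq> 0"
proof
  show "g = Fraction_Field.Fract (num g) (den g)" by simp
  show "num g \<noteq> 0" "den g \<noteq> 0"
    using assms by (simp_all add: Gplus_closure_iff_num_den)
  show "\<And>s. Re s < 0 \<Longrightarrow> poly (num g) s \<noteq> 0" "\<And>s. Re s < 0 \<Longrightarrow> poly (den g) s \<noteq> 0"
    using assms by (simp_all add: Gplus_closure_iff_num_den)
qed (rule ratfun_no_common_zero)

lemma Gplus_closure_mult:
  assumes "g \<in> Gplus_closure" "h \<in> Gplus_closure"
  shows "g * h \<in> Gplus_closure"
proof -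
  obtain a b where g: "g = Fraction_Field.Fract a b"
    "\<And>s. Re s < 0 \<Longrightarrow> poly a s \<noteq> 0" "\<And>s. Re s < 0 \<Longrightarrow> poly b s \<noteq> 0"
    using Gplus_closureE[OF assms(1)] by metis
  obtain c d where h: "h = Fraction_Field.Fract c d"
    "\<And>s. Re s < 0 \<Longrightarrow> poly c s \<noteq> 0" "\<And>s. Re s < 0 \<Longrightarrow> poly d s \<noteq> 0"
    using Gplus_closureE[OF assms(2)] by metis
  have "Fraction_Field.Fract (a * c) (b * d) \<in> Gplus_closure"
    using g(2,3) h(2,3) by (intro Fract_in_Gplus_closure) simp_all
  then show ?thesis unfolding g(1) h(1) mult_fract .
qed

lemma Gplus_closure_inverse:
  assumes "g \<in> Gplus_closure"
  shows "inverse g \<in> Gplus_closure"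
proof -
  obtain a b where g: "g = Fraction_Field.Fract a b"
    "\<And>s. Re s < 0 \<Longrightarrow> poly a s \<noteq> 0" "\<And>s. Re s < 0 \<Longrightarrow> poly b s \<noteq> 0"
    using Gplus_closureE[OF assms] by metis
  show ?thesis
    unfolding g(1) inverse_fract using g(2,3) by (intro Fract_in_Gplus_closure)
qed

section \<open>Cone and congruence structure of \<open>GP_of g\<close>\<close>

lemma GP_of_subset_gen_positive: "GP_of g \<subseteq> gen_positive_funs"
proof
  fix \<psi> assume "\<psi> \<in> GP_of g"
  then obtain p where p: "p \<in> positive_funs" "\<psi> = g * p * ratfun_sharp g"
    by (auto simp: GP_of_def)
  obtain a b where g: "g = Fraction_Field.Fract a b" "b \<noteq> 0" by (rule ratfun_cases)
  obtain u v where uv: "p = Fraction_Field.Fract u v" "v \<noteq> 0"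
    "\<And>s. Re s \<ge> 0 \<Longrightarrow> pos_pair_at u v s"
    using p(1) by (auto elim: positive_funsE)
  have "\<psi> = Fraction_Field.Fract (a * u * poly_sharp a) (b * v * poly_sharp b)"
    using p g uv by (simp add: ratfun_sharp_Fract)
  moreover have "\<dots> \<in> gen_positive_funs"
  proof (subst gen_positive_Fract_iff; safe?)
    fix s assume s: "Re s = 0"
    \<comment> \<open>Hence \<open>poly_sharp\<close> evaluates to the conjugate at
      \<open>s\<close>, and the outer factors contribute only squared moduli.\<close>
    then have cs: "- cnj s = s" by (simp add: complex_eq_iff)
    have "poly (a * u * poly_sharp a) s * cnj (poly (b * v * poly_sharp b) s) =
      of_real ((cmod (poly a s))\<^sup>2 * (cmod (poly b s))\<^sup>2) * (poly u s * cnj (poly v s))"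
      unfolding of_real_mult complex_norm_square by (simp add: poly_poly_sharp cs mult_ac)
    then have "Re (poly (a * u * poly_sharp a) s * cnj (poly (b * v * poly_sharp b) s)) =
      ((cmod (poly a s))\<^sup>2 * (cmod (poly b s))\<^sup>2) * Re (poly u s * cnj (poly v s))"
      by (simp only: Re_mult_of_real)
    then show "pos_pair_at (a * u * poly_sharp a) (b * v * poly_sharp b) s"
      unfolding pos_pair_at_def using uv(3)[of s] s by (simp add: pos_pair_at_def)
  qed (simp_all add: g(2) uv(2))
  ultimately show "\<psi> \<in> gen_positive_funs" by simp
qed

lemma zero_in_GP_of: "0 \<in> GP_of g"
proof -
  have "0 = g * 0 * ratfun_sharp g" by simp
  then show ?thesis
    unfolding GP_of_def using zero_in_positive_funs by blast
qed

lemma convex_cone_GP_of: "convex_cone (GP_of g)"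
  unfolding convex_cone_iff
proof safe
  show "0 \<in> GP_of g" by (rule zero_in_GP_of)
next
  fix x y assume "x \<in> GP_of g" "y \<in> GP_of g"
  then obtain p q where "p \<in> positive_funs" "x = g * p * ratfun_sharp g"
    "q \<in> positive_funs" "y = g * q * ratfun_sharp g" by (auto simp: GP_of_def)
  then have "p + q \<in> positive_funs" "x + y = g * (p + q) * ratfun_sharp g"
    by (simp_all add: positive_funs_add algebra_simps)
  then show "x + y \<in> GP_of g" by (auto simp: GP_of_def)
next
  fix x and c :: real assume "x \<in> GP_of g" "0 \<le> c"
  then obtain p where "p \<in> positive_funs" "x = g * p * ratfun_sharp g" by (auto simp: GP_of_def)
  then have "ratfun_const (of_real c) * p \<in> positive_funs"
    "c *\<^sub>R x = g * (ratfun_const (of_real c) * p) * ratfun_sharp g"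
    using \<open>0 \<le> c\<close> by (blast intro: positive_funs_scaleR, simp add: scaleR_ratfun mult_ac)
  then show "c *\<^sub>R x \<in> GP_of g" by (auto simp: GP_of_def)
qed

text \<open>Congruences compose because para-conjugation is multiplicative. With
  \<open>h = g2 / g1\<close> this relates the classes of \<open>g1\<close> and \<open>g2\<close>; it
  also lets factors be moved out in the factorization.\<close>

lemma ratfun_congr_GP_of: "ratfun_congr h (GP_of g) = GP_of (h * g)"
proof -
  have eq: "h * (g * p * ratfun_sharp g) * ratfun_sharp h = h * g * p * ratfun_sharp (h * g)" for p
    by (simp add: ratfun_sharp_mult mult_ac)
  have "ratfun_congr h (GP_of g) =
      {h * (g * p * ratfun_sharp g) * ratfun_sharp h | p. p \<in> positive_funs}"
    unfolding ratfun_congr_def GP_of_def by blast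
  then show ?thesis
    unfolding eq GP_of_def .
qed

subsection \<open>Positivity in the half plane from positivity on its boundary\<close>

lemma tendsto_poly_div_power_at_infinity:
  fixes p :: "complex poly"
  assumes "degree p \<le> n"
  shows "((\<lambda>s. poly p s / s ^ n) \<longlongrightarrow> coeff p n) at_infinity"
proof (cases "degree p = n")
  case True
  then show ?thesis using poly_divide_tendsto_aux[of p] by simp
next
  case False
  with assms have "degree p < degree (monom (1::complex) n)" by (simp add: degree_monom_eq)
  from poly_divide_tendsto_0_at_infinity[OF this] show ?thesis
    using False assms by (simp add: poly_monom coeff_eq_0)
qed

text \<open>Divided by \<open>s ^ n\<close>, the pencil tends to
  \<open>coeff u n + z0 * coeff v n\<close> as \<open>s\<close> goes to infinity and
  \<open>z\<close> to \<open>z0\<close> jointly. As this limit is nonzero, there are no roots of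
  large modulus for \<open>z\<close> near \<open>z0\<close>.\<close>

lemma pencil_roots_bounded:
  fixes u v :: "complex poly"
  assumes "degree u \<le> n" "degree v \<le> n" "coeff u n + z0 * coeff v n \<noteq> 0"
  obtains d R where "d > 0" "\<And>z s. dist z z0 < d \<Longrightarrow> poly u s + z * poly v s = 0 \<Longrightarrow> norm s \<le> R"
proof -
  let ?F = "\<lambda>(s, z). poly u s / s ^ n + z * (poly v s / s ^ n)"
  have "(?F \<longlongrightarrow> coeff u n + z0 * coeff v n) (at_infinity \<times>\<^sub>F nhds z0)"
    unfolding case_prod_beta
    by (intro tendsto_intros filterlim_compose[OF tendsto_poly_div_power_at_infinity[OF assms(1)]]
        filterlim_compose[OF tendsto_poly_div_power_at_infinity[OF assms(2)]]
        filterlim_fst filterlim_snd)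
  then have "\<forall>\<^sub>F x in at_infinity \<times>\<^sub>F nhds z0. ?F x \<noteq> 0"
    using assms(3) by (rule tendsto_imp_eventually_ne)
  then obtain P Q where PQ: "eventually P at_infinity" "eventually Q (nhds z0)"
    "\<And>s z. P s \<Longrightarrow> Q z \<Longrightarrow> ?F (s, z) \<noteq> 0"
    by (auto simp: eventually_prod_filter)
  obtain R where R: "\<And>s. norm s \<ge> R \<Longrightarrow> P s"
    using PQ(1) by (auto simp: eventually_at_infinity)
  obtain d where d: "d > 0" "\<And>z. dist z z0 < d \<Longrightarrow> Q z"
    using PQ(2) by (auto simp: eventually_nhds_metric)
  show ?thesis
  proof (rule that[OF d(1)])
    fix z s assume z: "dist z z0 < d" "poly u s + z * poly v s = 0"
    have "?F (s, z) = (poly u s + z * poly v s) / s ^ n"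
      by (simp add: add_divide_distrib)
    then have "\<not> P s"
      using PQ(3)[of s z] d(2)[OF z(1)] z(2) by auto
    then show "norm s \<le> R" using R[of s] by linarith
  qed
qed

lemma pencil_roots_convergent_subseq:
  fixes u v :: "complex poly"
  assumes "degree u \<le> n" "degree v \<le> n" "coeff u n + z0 * coeff v n \<noteq> 0"
    and z: "z \<longlonglongrightarrow> z0" and root: "\<And>k. poly u (s k) + z k * poly v (s k) = 0"
  obtains r l where "strict_mono r" "(s \<circ> r) \<longlonglongrightarrow> l" "poly u l + z0 * poly v l = 0"
proof -
  obtain d R where d: "d > 0" and
    R: "\<And>z s. dist z z0 < d \<Longrightarrow> poly u s + z * poly v s = 0 \<Longrightarrow> norm s \<le> R"
    using pencil_roots_bounded[OF assms(1-3)] by metis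
  obtain N where N: "\<And>k. k \<ge> N \<Longrightarrow> dist (z k) z0 < d"
    using z d unfolding lim_sequentially by blast
  have "bounded (range (\<lambda>k. s (k + N)))"
    using R[OF N root] by (intro boundedI[of _ R]) auto
  then obtain r l where r: "strict_mono r" "((\<lambda>k. s (k + N)) \<circ> r) \<longlonglongrightarrow> l"
    using bounded_imp_convergent_subsequence by blast
  have mono: "strict_mono (\<lambda>k. r k + N)"
    using r(1) by (simp add: strict_mono_def)
  show ?thesis
  proof
    show "strict_mono (\<lambda>k. r k + N)" by fact
    show lim: "(s \<circ> (\<lambda>k. r k + N)) \<longlonglongrightarrow> l" using r(2) by (simp add: o_def)
    have "(\<lambda>k. poly u ((s \<circ> (\<lambda>k. r k + N)) k) + (z \<circ> (\<lambda>k. r k + N)) k * poly v ((s \<circ> (\<lambda>k. r k + N)) k))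
        \<longlonglongrightarrow> poly u l + z0 * poly v l"
      by (intro tendsto_intros lim LIMSEQ_subseq_LIMSEQ[OF z mono])
    then show "poly u l + z0 * poly v l = 0"
      using root by (simp add: o_def LIMSEQ_const_iff)
  qed
qed

text \<open>The sign condition at infinity: along \<open>\<i> * (k + 1)\<close>, dividing
  \<open>u\<close> and \<open>v\<close> by \<open>s ^ n\<close> only divides the tested real part by
  a positive number, and the quotients tend to the coefficients.\<close>

lemma pos_pair_lead_coeff:
  assumes "\<And>s. Re s = 0 \<Longrightarrow> pos_pair_at u v s" "degree u \<le> n" "degree v \<le> n"
  shows "Re (coeff u n * cnj (coeff v n)) \<ge> 0"
proof -
  define s where "s k = \<i> * of_nat (Suc k)" for k
  have nz: "s k \<noteq> 0" for k by (simp add: s_def del: of_nat_Suc)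
  have "filterlim s at_infinity sequentially"
    unfolding s_def
    by (intro tendsto_mult_filterlim_at_infinity[of _ "\<i>"] tendsto_const
        filterlim_compose[OF tendsto_of_nat filterlim_Suc]) simp
  note lim = filterlim_compose[OF tendsto_poly_div_power_at_infinity this]
  have "(\<lambda>k. Re (poly u (s k) / s k ^ n * cnj (poly v (s k) / s k ^ n)))
      \<longlonglongrightarrow> Re (coeff u n * cnj (coeff v n))"
    by (intro tendsto_intros lim assms)
  moreover have "Re (poly u (s k) / s k ^ n * cnj (poly v (s k) / s k ^ n)) \<ge> 0" for k
  proof -
    have "poly u (s k) / s k ^ n * cnj (poly v (s k) / s k ^ n) =
        poly u (s k) * cnj (poly v (s k)) / of_real ((cmod (s k ^ n))\<^sup>2)"
      unfolding complex_norm_square by simp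
    then have "Re (poly u (s k) / s k ^ n * cnj (poly v (s k) / s k ^ n)) =
        Re (poly u (s k) * cnj (poly v (s k))) / (cmod (s k ^ n))\<^sup>2"
      by (simp only: Re_divide_of_real)
    moreover have "pos_pair_at u v (s k)" by (rule assms(1)) (simp add: s_def)
    ultimately show ?thesis by (simp add: pos_pair_at_def)
  qed
  ultimately show ?thesis
    by (intro LIMSEQ_le_const) auto
qed

lemma infinite_Re_pos: "infinite {s. Re s > 0}"
proof
  assume "finite {s. Re s > 0}"
  moreover have "(\<lambda>n. of_nat (Suc n)) ` UNIV \<subseteq> {s. Re s > 0}" by auto
  ultimately have "finite ((\<lambda>n. of_nat (Suc n) :: complex) ` UNIV)" using finite_subset by blast
  then show False
    by (subst (asm) finite_image_iff) (auto simp: inj_on_def simp del: of_nat_Suc)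
qed

lemma poly_eqI_Re_pos:
  assumes "\<And>s. Re s > 0 \<Longrightarrow> poly p s = poly q s"
  shows "p = q"
proof (rule ccontr)
  assume "p \<noteq> q"
  then have "finite {s. poly (p - q) s = 0}" by (intro poly_roots_finite) simp
  moreover have "{s. Re s > 0} \<subseteq> {s. poly (p - q) s = 0}" using assms by auto
  ultimately show False using infinite_Re_pos finite_subset by blast
qed

text \<open>Serves twice: for the openness of the set of pencil parameters with a root in the half
  plane, and to exclude zeros of positive functions there.\<close>

lemma open_image_quotient:
  assumes "\<And>s. Re s > 0 \<Longrightarrow> poly v s \<noteq> 0" "\<And>c. u \<noteq> smult c v"
  shows "open ((\<lambda>s. poly u s / poly v s) ` {s. Re s > 0})"
proof (rule open_mapping_thm)
  show "(\<lambda>s. poly u s / poly v s) holomorphic_on {s. Re s > 0}"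
    using assms(1) by (auto intro!: holomorphic_intros)
  show "connected {s. Re s > 0}" by (intro convex_connected convex_halfspace_Re_gt)
  show "\<not> (\<lambda>s. poly u s / poly v s) constant_on {s. Re s > 0}"
  proof
    assume "(\<lambda>s. poly u s / poly v s) constant_on {s. Re s > 0}"
    then obtain c where "\<And>s. Re s > 0 \<Longrightarrow> poly u s / poly v s = c"
      by (auto simp: constant_on_def)
    then have "u = smult c v"
      using assms(1) by (intro poly_eqI_Re_pos) (auto simp: field_simps)
    with assms(2) show False by blast
  qed
qed (simp_all add: open_halfspace_Re_gt)

text \<open>The sign condition says that \<open>u / v\<close> has a simple zero whose derivative has
  positive real part.\<close>

definition simple_pos_zero :: "complex poly \<Rightarrow> complex poly \<Rightarrow> complex \<Rightarrow> bool" where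
  "simple_pos_zero u v s \<longleftrightarrow> (\<exists>U. u = [:- s, 1:] * U \<and> Re (poly U s * cnj (poly v s)) > 0)"

text \<open>By contradiction: a point \<open>s0\<close> violating the sign condition is a root of
  the pencil for a parameter with positive real part. A connectedness argument spreads this to all
  such parameters, and for parameters near 0 the roots would lie to the right of an imaginary zero
  of \<open>u\<close>, against the sign of the derivative there.\<close>

lemma pos_pair_half_plane_degree_le:
  assumes v: "\<And>s. Re s > 0 \<Longrightarrow> poly v s \<noteq> 0" and u: "\<And>s. Re s > 0 \<Longrightarrow> poly u s \<noteq> 0"
    and zero: "\<And>s. Re s = 0 \<Longrightarrow> poly u s = 0 \<Longrightarrow> simple_pos_zero u v s"
    and pos: "\<And>s. Re s = 0 \<Longrightarrow> pos_pair_at u v s"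
    and deg: "degree v \<le> degree u" and "Re s0 > 0"
  shows "pos_pair_at u v s0"
proof (rule ccontr)
  assume neg: "\<not> pos_pair_at u v s0"
  define n where "n = degree u"
  have degs: "degree u \<le> n" "degree v \<le> n" using deg by (simp_all add: n_def)
  let ?H = "{s. Re s > 0}"
  have common: "poly u s \<noteq> 0 \<or> poly v s \<noteq> 0" if "Re s = 0" for s
    using zero[OF that] by (auto simp: simple_pos_zero_def)
  have "u \<noteq> 0" using u[of 1] by auto
  \<comment> \<open>No root escapes to infinity. For \<open>z = 0\<close> this is the choice
    \<open>n = degree u\<close>; for \<open>Re z > 0\<close>, a cancellation would make
    \<open>u / v\<close> tend to \<open>- z\<close>, against the sign condition at infinity.\<close>
  have lead: "coeff u n + z * coeff v n \<noteq> 0" if "z = 0 \<or> Re z > 0" for z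
  proof
    assume eq: "coeff u n + z * coeff v n = 0"
    have "coeff u n \<noteq> 0" using \<open>u \<noteq> 0\<close> by (simp add: n_def)
    with eq that have z: "Re z > 0" and "coeff v n \<noteq> 0" by auto
    have "coeff u n = - z * coeff v n" using eq by (simp add: add_eq_0_iff2)
    then have "coeff u n * cnj (coeff v n) = of_real ((cmod (coeff v n))\<^sup>2) * (- z)"
      unfolding complex_norm_square by simp
    then have "Re (coeff u n * cnj (coeff v n)) = (cmod (coeff v n))\<^sup>2 * Re (- z)"
      by (simp only: Re_mult_of_real)
    moreover have "\<dots> < 0" using z \<open>coeff v n \<noteq> 0\<close> by simp
    ultimately show False
      using pos_pair_lead_coeff[OF pos, of n] deg by (simp add: n_def)
  qed
  define Z where "Z = {z \<in> ?H. \<exists>s\<in>?H. poly u s + z * poly v s = 0}"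
  have Z_eq: "Z = ?H \<inter> uminus ` ((\<lambda>s. poly u s / poly v s) ` ?H)"
  proof -
    have "poly u s + z * poly v s = 0 \<longleftrightarrow> z = - (poly u s / poly v s)" if "Re s > 0" for s z
      unfolding add_eq_0_iff minus_divide_left nonzero_eq_divide_eq[OF v[OF that]] ..
    then show ?thesis unfolding Z_def by blast
  qed
  define z1 where "z1 = - (poly u s0 / poly v s0)"
  have Rez1: "Re z1 > 0"
    using neg v[OF \<open>Re s0 > 0\<close>] Re_divide_nonneg_iff[of "poly v s0" "poly u s0"]
    by (simp add: z1_def pos_pair_at_def not_le)
  have "z1 \<in> Z"
    using Rez1 \<open>Re s0 > 0\<close> unfolding Z_eq z1_def by auto
  \<comment> \<open>A constant quotient would equal \<open>- z1\<close>, which already violates the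
    sign condition at the point 0 of the axis.\<close>
  have nonconst: "u \<noteq> smult c v" for c
  proof
    assume uc: "u = smult c v"
    have v0: "poly v 0 \<noteq> 0" using common[of 0] uc by auto
    have "c = - z1" using uc v[OF \<open>Re s0 > 0\<close>] by (simp add: z1_def)
    then have "poly u 0 * cnj (poly v 0) = of_real ((cmod (poly v 0))\<^sup>2) * (- z1)"
      unfolding complex_norm_square uc by simp
    then have "Re (poly u 0 * cnj (poly v 0)) = (cmod (poly v 0))\<^sup>2 * Re (- z1)"
      by (simp only: Re_mult_of_real)
    moreover have "\<dots> < 0" using Rez1 v0 by simp
    ultimately show False using pos[of 0] by (simp add: pos_pair_at_def)
  qed
  have "open Z"
    unfolding Z_eq
    by (intro open_Int open_halfspace_Re_gt open_negations open_image_quotient v nonconst)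
  \<comment> \<open>Roots for parameters converging to \<open>z0\<close> accumulate at some root
    \<open>l\<close> with \<open>Re l \<ge> 0\<close>. It cannot be imaginary, since
    \<open>u / v\<close> would equal \<open>- z0\<close> there and have negative real part.\<close>
  moreover have "closedin (top_of_set ?H) Z"
    unfolding closedin_limpt
  proof safe
    fix z assume "z \<in> Z" then show "0 < Re z" by (simp add: Z_def)
  next
    fix z0 assume "z0 islimpt Z" and z0: "0 < Re z0"
    then obtain z where z: "\<And>k. z k \<in> Z" "z \<longlonglongrightarrow> z0"
      unfolding islimpt_sequential by blast
    then obtain s where s: "\<And>k. Re (s k) > 0" "\<And>k. poly u (s k) + z k * poly v (s k) = 0"
      unfolding Z_def by simp metis
    obtain r l where r: "strict_mono r" "(s \<circ> r) \<longlonglongrightarrow> l" "poly u l + z0 * poly v l = 0"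
      by (rule pencil_roots_convergent_subseq[OF degs lead[OF disjI2[OF z0]] z(2) s(2)])
    have "Re l \<ge> 0"
      using tendsto_Re[OF r(2)] s(1) by (intro LIMSEQ_le_const) (auto intro: less_imp_le)
    moreover have "Re l \<noteq> 0"
    proof
      assume l: "Re l = 0"
      have eq: "poly u l = - z0 * poly v l" using r(3) by (simp add: add_eq_0_iff2)
      then have vl: "poly v l \<noteq> 0" using common[OF l] by auto
      have "poly u l * cnj (poly v l) = of_real ((cmod (poly v l))\<^sup>2) * (- z0)"
        unfolding complex_norm_square eq by simp
      then have "Re (poly u l * cnj (poly v l)) = (cmod (poly v l))\<^sup>2 * Re (- z0)"
        by (simp only: Re_mult_of_real)
      moreover have "\<dots> < 0" using z0 vl by simp
      ultimately show False using pos[OF l] by (simp add: pos_pair_at_def)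
    qed
    ultimately have "l \<in> ?H" by simp
    then show "z0 \<in> Z"
      using z0 r(3) unfolding Z_def by blast
  qed
  ultimately have "Z = ?H"
    using convex_connected[OF convex_halfspace_Re_gt[of 0]] \<open>z1 \<in> Z\<close>
    unfolding connected_clopen openin_open_eq[OF open_halfspace_Re_gt] by (auto simp: Z_def)
  \<comment> \<open>Parameters \<open>t k\<close> decreasing to 0 have roots in the half plane;
    these accumulate at a zero \<open>l\<close> of \<open>u\<close>, which must be
    imaginary.\<close>
  define t where "t k = inverse (real (Suc k))" for k
  have tpos: "t k > 0" for k by (simp add: t_def)
  have "of_real (t k) \<in> Z" for k
    unfolding \<open>Z = ?H\<close> using tpos by simp
  then obtain s where s: "\<And>k. Re (s k) > 0" "\<And>k. poly u (s k) + of_real (t k) * poly v (s k) = 0"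
    unfolding Z_def by simp metis
  have "(\<lambda>k. complex_of_real (t k)) \<longlonglongrightarrow> of_real 0"
    unfolding t_def by (intro tendsto_of_real LIMSEQ_inverse_real_of_nat)
  then obtain r l where r: "strict_mono r" "(s \<circ> r) \<longlonglongrightarrow> l" "poly u l = 0"
    using pencil_roots_convergent_subseq[of u n v 0 "\<lambda>k. of_real (t k)" s, OF degs lead _ s(2)]
    by auto
  have "Re l \<ge> 0"
    using tendsto_Re[OF r(2)] s(1) by (intro LIMSEQ_le_const) (auto intro: less_imp_le)
  then have l: "Re l = 0" using u[of l] r(3) by fastforce
  obtain U where U: "u = [:- l, 1:] * U" "Re (poly U l * cnj (poly v l)) > 0"
    using zero[OF l r(3)] by (auto simp: simple_pos_zero_def)
  have "(\<lambda>k. Re (poly U ((s \<circ> r) k) * cnj (poly v ((s \<circ> r) k)))) \<longlonglongrightarrow> Re (poly U l * cnj (poly v l))"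
    by (intro tendsto_intros r(2))
  from order_tendstoD(1)[OF this U(2)]
  obtain k where k: "Re (poly U (s (r k)) * cnj (poly v (s (r k)))) > 0"
    by (auto simp: eventually_sequentially)
  \<comment> \<open>A root so close to \<open>l\<close> that the sign at \<open>l\<close> persists.
    The root equation \<open>(a - l) * U = - t * v\<close> at \<open>a\<close>, multiplied by the
    conjugate of \<open>U\<close>, makes \<open>Re (a - l)\<close> nonpositive with a strictly
    negative right side, whereas \<open>Re a > 0 = Re l\<close>.\<close>
  define a where "a = s (r k)"
  have "(a - l) * poly U a = - of_real (t (r k)) * poly v a"
    using s(2)[of "r k"] unfolding U(1) a_def[symmetric] by (simp add: eq_neg_iff_add_eq_0 algebra_simps)
  then have "(a - l) * poly U a * cnj (poly U a) = of_real (- t (r k)) * (poly v a * cnj (poly U a))"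
    by simp
  then have "of_real ((cmod (poly U a))\<^sup>2) * (a - l) = of_real (- t (r k)) * (poly v a * cnj (poly U a))"
    unfolding complex_norm_square by (simp only: mult_ac)
  then have "(cmod (poly U a))\<^sup>2 * Re (a - l) = - t (r k) * Re (poly v a * cnj (poly U a))"
    by (metis Re_mult_of_real(1))
  moreover have "Re (poly v a * cnj (poly U a)) > 0"
    using k by (simp add: a_def algebra_simps)
  moreover have "(cmod (poly U a))\<^sup>2 * Re (a - l) \<ge> 0"
    using s(1)[of "r k"] l by (simp add: a_def)
  ultimately show False
    using mult_pos_pos[OF tpos[of "r k"]] by fastforce
qed

text \<open>All hypotheses are symmetric in \<open>u\<close> and \<open>v\<close>, so the polynomial
  of larger degree can take the role of \<open>u\<close>.\<close>

lemma pos_pair_half_plane: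
  assumes "\<And>s. Re s > 0 \<Longrightarrow> poly u s \<noteq> 0" "\<And>s. Re s > 0 \<Longrightarrow> poly v s \<noteq> 0"
    and "\<And>s. Re s = 0 \<Longrightarrow> poly u s = 0 \<Longrightarrow> simple_pos_zero u v s"
    and "\<And>s. Re s = 0 \<Longrightarrow> poly v s = 0 \<Longrightarrow> simple_pos_zero v u s"
    and "\<And>s. Re s = 0 \<Longrightarrow> pos_pair_at u v s" "Re s > 0"
  shows "pos_pair_at u v s"
proof (cases "degree v \<le> degree u")
  case True
  show ?thesis by (rule pos_pair_half_plane_degree_le[OF assms(2,1,3,5) True assms(6)])
next
  case False
  then have deg: "degree u \<le> degree v" by simp
  have "pos_pair_at v u s"
    by (rule pos_pair_half_plane_degree_le[OF assms(1,2,4) assms(5)[unfolded pos_pair_at_commute[of u]]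
        deg assms(6)])
  then show ?thesis unfolding pos_pair_at_commute[of v] .
qed

subsection \<open>Zeros of positive functions\<close>

text \<open>If \<open>u / v\<close> took the value 0 in the open half plane, its image, being open,
  would contain negative numbers.\<close>

lemma positive_pair_nonzero:
  assumes "\<And>s. Re s > 0 \<Longrightarrow> poly v s \<noteq> 0" "\<And>s. Re s > 0 \<Longrightarrow> pos_pair_at u v s"
    and "u \<noteq> 0" "Re s > 0"
  shows "poly u s \<noteq> 0"
proof
  assume us: "poly u s = 0"
  let ?I = "(\<lambda>s. poly u s / poly v s) ` {s. Re s > 0}"
  have "u \<noteq> smult c v" for c using us assms(1,3) \<open>Re s > 0\<close> by auto
  then have "open ?I" using assms(1) by (intro open_image_quotient)
  moreover have "0 \<in> ?I" using us \<open>Re s > 0\<close> by force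
  ultimately obtain e where "e > 0" "cball 0 e \<subseteq> ?I" using open_contains_cball by blast
  moreover have "complex_of_real (- e) \<in> cball 0 e" using \<open>e > 0\<close> by simp
  ultimately obtain w where w: "Re w > 0" "complex_of_real (- e) = poly u w / poly v w" by blast
  have "Re (poly u w / poly v w) \<ge> 0"
    using assms(1,2)[OF w(1)] by (simp add: Re_divide_nonneg_iff pos_pair_at_def)
  then show False using w(2) \<open>e > 0\<close> by (metis Re_complex_of_real neg_0_le_iff_le not_le)
qed

text \<open>For \<open>k \<ge> 2\<close> the \<open>k\<close>-th powers of the closed right half
  plane fill the whole plane, so \<open>w ^ k * c\<close> takes the value -1. For
  \<open>k = 1\<close>, the test points 1, \<open>\<i>\<close> and \<open>- \<i>\<close> force
  \<open>c\<close> to be real and nonnegative.\<close>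

lemma Re_power_half_plane:
  assumes "\<And>w. Re w \<ge> 0 \<Longrightarrow> Re (w ^ k * c) \<ge> 0" "k > 0" "c \<noteq> 0"
  shows "k = 1" "Re c > 0"
proof -
  show "k = 1"
  proof (rule ccontr)
    assume "k \<noteq> 1"
    then have k: "k \<ge> 2" using assms(2) by simp
    \<comment> \<open>The principal root \<open>w\<close> of \<open>- 1 / c\<close> has argument at
      most pi / k in modulus, hence at most pi / 2.\<close>
    define L where "L = Ln (- 1 / c)"
    define w where "w = exp (L / of_nat k)"
    have "w ^ k = exp L"
      using k by (simp add: w_def flip: exp_of_nat_mult)
    also have "\<dots> = - 1 / c" using assms(3) by (simp add: L_def)
    finally have "w ^ k * c = - 1" using assms(3) by simp
    moreover have "Re w \<ge> 0"
    proof -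
      have "\<bar>Im L\<bar> \<le> pi"
        using assms(3) mpi_less_Im_Ln[of "- 1 / c"] Im_Ln_le_pi[of "- 1 / c"] by (auto simp: L_def)
      moreover have "\<bar>Im L / real k\<bar> \<le> \<bar>Im L\<bar> / 2"
        unfolding abs_divide using k by (intro divide_left_mono) auto
      ultimately have "\<bar>Im L / real k\<bar> \<le> pi / 2" by linarith
      then have "cos (Im L / real k) \<ge> 0"
        by (intro cos_ge_zero) linarith+
      then show ?thesis by (simp add: w_def Re_exp)
    qed
    ultimately show False using assms(1)[of w] by simp
  qed
  then have "Re c \<ge> 0" "Im c \<le> 0" "Im c \<ge> 0"
    using assms(1)[of 1] assms(1)[of "\<i>"] assms(1)[of "- \<i>"] by auto
  then show "Re c > 0" using assms(3) by (auto simp: complex_eq_iff less_le)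
qed

text \<open>Let \<open>k\<close> be the order of the zero. Along \<open>s0 + t * w\<close> with
  \<open>Re w \<ge> 0\<close>, dividing the sign condition by \<open>t ^ k\<close> and letting
  \<open>t\<close> tend to 0 leaves \<open>Re (w ^ k * c) \<ge> 0\<close>, which forces
  \<open>k = 1\<close> and \<open>Re c > 0\<close>.\<close>

lemma positive_pair_simple_zero:
  assumes "\<And>s. Re s \<ge> 0 \<Longrightarrow> pos_pair_at u v s"
    and "u \<noteq> 0" "Re s0 = 0" "poly u s0 = 0" "poly v s0 \<noteq> 0"
  shows "simple_pos_zero u v s0"
proof -
  define k where "k = order s0 u"
  obtain U where U: "u = [:- s0, 1:] ^ k * U" "poly U s0 \<noteq> 0"
    using order_decomp[OF assms(2), of s0] by (auto simp: k_def poly_eq_0_iff_dvd)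
  have "k > 0" using assms(2,4) by (simp add: k_def order_gt_0_iff)
  define c where "c = poly U s0 * cnj (poly v s0)"
  have "Re (w ^ k * c) \<ge> 0" if w: "Re w \<ge> 0" for w
  proof -
    define t where "t n = inverse (real (Suc n))" for n
    define g where "g n = s0 + of_real (t n) * w" for n
    have tpos: "t n > 0" for n by (simp add: t_def)
    have "g \<longlonglongrightarrow> s0 + of_real 0 * w"
      unfolding g_def t_def by (intro tendsto_intros LIMSEQ_inverse_real_of_nat)
    then have g: "g \<longlonglongrightarrow> s0" by simp
    have "(\<lambda>n. Re (w ^ k * (poly U (g n) * cnj (poly v (g n))))) \<longlonglongrightarrow> Re (w ^ k * c)"
      unfolding c_def by (intro tendsto_intros g)
    moreover have "Re (w ^ k * (poly U (g n) * cnj (poly v (g n)))) \<ge> 0" for n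
    proof -
      have "pos_pair_at u v (g n)"
        using assms(3) w tpos[of n] by (intro assms(1)) (simp add: g_def)
      moreover have "poly u (g n) * cnj (poly v (g n)) =
          of_real (t n ^ k) * (w ^ k * (poly U (g n) * cnj (poly v (g n))))"
        unfolding U(1) by (simp add: g_def power_mult_distrib)
      ultimately have "t n ^ k * Re (w ^ k * (poly U (g n) * cnj (poly v (g n)))) \<ge> 0"
        unfolding pos_pair_at_def by (metis Re_mult_of_real(1))
      moreover have "t n ^ k > 0" using tpos[of n] by simp
      ultimately show ?thesis by (simp only: zero_le_mult_iff) linarith
    qed
    ultimately show ?thesis by (intro LIMSEQ_le_const) auto
  qed
  from Re_power_half_plane[OF this \<open>k > 0\<close>] have "k = 1" "Re c > 0"
    using U(2) assms(5) by (auto simp: c_def)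
  then show ?thesis
    using U(1) by (auto simp: simple_pos_zero_def c_def)
qed

lemma positive_funs_inverse:
  assumes "p \<in> positive_funs" "p \<noteq> 0"
  shows "inverse p \<in> positive_funs"
proof -
  obtain u v where p: "p = Fraction_Field.Fract u v" "v \<noteq> 0"
    "\<And>s. Re s > 0 \<Longrightarrow> poly v s \<noteq> 0" "\<And>s. Re s \<ge> 0 \<Longrightarrow> pos_pair_at u v s"
    using positive_funsE[OF assms(1)] by metis
  have "u \<noteq> 0" using assms(2) p(1,2) by (auto simp: Zero_fract_def eq_fract)
  have "Fraction_Field.Fract v u \<in> positive_funs"
  proof (rule positive_Fract)
    fix s :: complex assume s: "Re s > 0"
    show "poly u s \<noteq> 0"
      using p(3,4) \<open>u \<noteq> 0\<close> s by (intro positive_pair_nonzero[of v u]) simp_all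
    show "pos_pair_at v u s"
      unfolding pos_pair_at_commute[of v] using s by (intro p(4)) simp
  qed
  then show ?thesis unfolding p(1) inverse_fract .
qed

text \<open>Inverting \<open>g * p * ratfun_sharp g\<close> inverts each factor, and the inverse of
  \<open>g\<close> is the para-conjugate of \<open>inverse (ratfun_sharp g)\<close>; nonzero
  positive functions are closed under inversion.\<close>

lemma GP_of_inverse:
  assumes "g \<noteq> 0"
  shows "ratfun_set_inverse (GP_of g) = GP_of (inverse (ratfun_sharp g)) - {0}"
proof (intro equalityI subsetI)
  fix x assume "x \<in> ratfun_set_inverse (GP_of g)"
  then obtain p where p: "p \<in> positive_funs" "x = inverse (g * p * ratfun_sharp g)"
    "g * p * ratfun_sharp g \<noteq> 0"
    unfolding ratfun_set_inverse_def GP_of_def by blast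
  then have "inverse p \<in> positive_funs" by (intro positive_funs_inverse) auto
  moreover have "x = inverse (ratfun_sharp g) * inverse p * ratfun_sharp (inverse (ratfun_sharp g))"
    by (simp add: p(2) ratfun_sharp_inverse mult_ac)
  ultimately show "x \<in> GP_of (inverse (ratfun_sharp g)) - {0}"
    using p(2,3) unfolding GP_of_def by auto
next
  fix x assume "x \<in> GP_of (inverse (ratfun_sharp g)) - {0}"
  then obtain p where p: "p \<in> positive_funs" "x \<noteq> 0"
    "x = inverse (ratfun_sharp g) * p * ratfun_sharp (inverse (ratfun_sharp g))"
    unfolding GP_of_def by blast
  then have "p \<noteq> 0" by auto
  then have "inverse p \<in> positive_funs" using p(1) by (intro positive_funs_inverse)
  then have "g * inverse p * ratfun_sharp g \<in> GP_of g" unfolding GP_of_def by blast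
  moreover have "x = inverse (g * inverse p * ratfun_sharp g)"
    by (simp add: p(3) ratfun_sharp_inverse mult_ac)
  moreover have "g * inverse p * ratfun_sharp g \<noteq> 0" using assms \<open>p \<noteq> 0\<close> by simp
  ultimately show "x \<in> ratfun_set_inverse (GP_of g)"
    unfolding ratfun_set_inverse_def by blast
qed

subsection \<open>Congruent positive functions\<close>

lemma minus_cnj_imaginary: "Re s = 0 \<Longrightarrow> - cnj s = s"
  by (simp add: complex_eq_iff)

lemma poly_linear_sharp:
  assumes "Re s = 0"
  shows "poly [:- cnj a, -1:] s = cnj (poly [:- a, 1:] s)"
  using minus_cnj_imaginary[OF assms] by (simp add: minus_equation_iff)

text \<open>If \<open>x * y\<close> were a nonpositive real, \<open>y\<close> would be a nonpositive
  multiple of \<open>cnj x\<close>, which has positive real part.\<close>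

lemma Re_pos_mult_not_nonpos:
  assumes "Re x > 0" "Re y > 0" "x * y * of_real b = - of_real r" "b > 0" "r \<ge> 0"
  shows False
proof -
  have "of_real ((cmod x)\<^sup>2 * b) * y = cnj x * (x * y * of_real b)"
    unfolding of_real_mult complex_norm_square by (simp only: mult_ac)
  also have "\<dots> = of_real (- r) * cnj x"
    unfolding assms(3) by simp
  finally have "((cmod x)\<^sup>2 * b) * Re y = - r * Re (cnj x)"
    by (metis Re_mult_of_real(1))
  moreover have "((cmod x)\<^sup>2 * b) * Re y > 0"
    using assms by (intro mult_pos_pos) auto
  moreover have "- r * Re (cnj x) \<le> 0" using assms by simp
  ultimately show False by linarith
qed

text \<open>With \<open>f = a / b\<close>, the last hypothesis is
  \<open>p1 = f * p2 * ratfun_sharp f\<close> cleared of denominators. The statement is kept at the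
  level of polynomials so that exchanging \<open>a\<close> with \<open>b\<close> and the two pairs
  treats the poles of \<open>f\<close> as well.\<close>

lemma congruent_positive_no_zero:
  assumes a: "\<And>s. Re s < 0 \<Longrightarrow> poly a s \<noteq> 0" and b: "\<And>s. Re s < 0 \<Longrightarrow> poly b s \<noteq> 0"
    and ab: "\<And>s. poly a s \<noteq> 0 \<or> poly b s \<noteq> 0"
    and u1: "u1 \<noteq> 0" "\<And>s. Re s > 0 \<Longrightarrow> poly v1 s \<noteq> 0" "\<And>s. Re s \<ge> 0 \<Longrightarrow> pos_pair_at u1 v1 s"
      "\<And>s. poly u1 s \<noteq> 0 \<or> poly v1 s \<noteq> 0"
    and u2: "v2 \<noteq> 0" "\<And>s. Re s > 0 \<Longrightarrow> poly v2 s \<noteq> 0" "\<And>s. Re s \<ge> 0 \<Longrightarrow> pos_pair_at u2 v2 s"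
      "\<And>s. poly u2 s \<noteq> 0 \<or> poly v2 s \<noteq> 0"
    and eq: "u1 * v2 * (b * poly_sharp b) = u2 * v1 * (a * poly_sharp a)"
  shows "poly a s \<noteq> 0"
proof
  assume as: "poly a s = 0"
  then have bs: "poly b s \<noteq> 0" using ab by blast
  have "Re s \<ge> 0" using a as by (meson not_le)
  have evaleq: "poly u1 s * poly v2 s * (poly b s * poly (poly_sharp b) s) = 0"
    using arg_cong[OF eq, of "\<lambda>p. poly p s"] as by simp
  show False
  proof (cases "Re s = 0")
    case False
    with \<open>Re s \<ge> 0\<close> have s: "Re s > 0" by simp
    \<comment> \<open>All factors on the left of the identity are nonzero at \<open>s\<close>; for
      \<open>poly_sharp b\<close> this is so because \<open>- cnj s\<close> lies in the left half
      plane.\<close>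
    have "poly u1 s \<noteq> 0"
      using u1(1-3) s by (intro positive_pair_nonzero[of v1 u1]) simp_all
    moreover have "poly b (- cnj s) \<noteq> 0" using s by (intro b) simp
    ultimately show False
      using evaleq u2(2)[OF s] bs by (simp add: poly_poly_sharp)
  next
    case True
    let ?L = "[:- s, 1:]"
    have L: "?L \<noteq> 0" by simp
    have cs: "- cnj s = s" using True by (rule minus_cnj_imaginary)
    obtain a1 where a1: "a = ?L * a1" using as by (auto simp: poly_eq_0_iff_dvd dvd_def)
    have "poly_sharp a = - ?L * poly_sharp a1"
      unfolding a1 poly_sharp_mult poly_sharp_linear cs by simp
    \<comment> \<open>An imaginary zero is shared by \<open>a\<close> and
      \<open>poly_sharp a\<close>, so the right side has a double zero at \<open>s\<close>. The
      minus sign comes from \<open>poly_sharp\<close> of the linear factor and decides the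
      proof.\<close>
    then have eq2: "u1 * v2 * (b * poly_sharp b) = ?L * (?L * (- (u2 * v1 * (a1 * poly_sharp a1))))"
      unfolding eq a1 by (simp only: mult_minus_left mult_minus_right mult_ac)
    have simple1: "simple_pos_zero u1 v1 s" if "poly u1 s = 0"
      using u1(3,1) True that u1(4)[of s] by (intro positive_pair_simple_zero) auto
    have simple2: "simple_pos_zero v2 u2 s" if "poly v2 s = 0"
    proof (rule positive_pair_simple_zero)
      show "pos_pair_at v2 u2 s" if "Re s \<ge> 0" for s
        unfolding pos_pair_at_commute[of v2] using that by (rule u2(3))
    qed (use True that u2(1) u2(4)[of s] in auto)
    have bsharp: "poly (poly_sharp b) s = cnj (poly b s)" "poly (poly_sharp a1) s = cnj (poly a1 s)"
      by (simp_all add: poly_poly_sharp cs)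
    \<comment> \<open>Zeros of \<open>u1\<close> and \<open>v2\<close> at \<open>s\<close> are at
      most simple and \<open>b\<close> does not vanish, so a double zero requires both to vanish.
      First \<open>u1\<close>, then \<open>v2\<close>, each by cancelling one linear factor.\<close>
    have "poly u1 s = 0"
    proof (rule ccontr)
      assume nz: "poly u1 s \<noteq> 0"
      with evaleq have "poly v2 s = 0" using bs bsharp by simp
      then obtain V where V: "v2 = ?L * V" "Re (poly V s * cnj (poly u2 s)) > 0"
        using simple2 by (auto simp: simple_pos_zero_def)
      have "?L * (u1 * V * (b * poly_sharp b)) = ?L * (?L * (- (u2 * v1 * (a1 * poly_sharp a1))))"
        unfolding eq2[symmetric] V(1) by (simp only: mult_ac)
      then have "u1 * V * (b * poly_sharp b) = ?L * (- (u2 * v1 * (a1 * poly_sharp a1)))"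
        using L by (simp only: mult_cancel_left) simp
      then have "poly (u1 * V * (b * poly_sharp b)) s = 0" by simp
      then show False using nz bs bsharp V(2) by auto
    qed
    then obtain U where U: "u1 = ?L * U" "Re (poly U s * cnj (poly v1 s)) > 0"
      using simple1 by (auto simp: simple_pos_zero_def)
    have "?L * (U * v2 * (b * poly_sharp b)) = ?L * (?L * (- (u2 * v1 * (a1 * poly_sharp a1))))"
      unfolding eq2[symmetric] U(1) by (simp only: mult_ac)
    then have eq3: "U * v2 * (b * poly_sharp b) = ?L * (- (u2 * v1 * (a1 * poly_sharp a1)))"
      using L by (simp only: mult_cancel_left) simp
    then have "poly (U * v2 * (b * poly_sharp b)) s = 0" by simp
    then have "poly v2 s = 0" using bs bsharp U(2) by auto
    then obtain V where V: "v2 = ?L * V" "Re (poly V s * cnj (poly u2 s)) > 0"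
      using simple2 by (auto simp: simple_pos_zero_def)
    have "?L * (U * V * (b * poly_sharp b)) = ?L * (- (u2 * v1 * (a1 * poly_sharp a1)))"
      unfolding eq3[symmetric] V(1) by (simp only: mult_ac)
    then have "U * V * (b * poly_sharp b) = - (u2 * v1 * (a1 * poly_sharp a1))"
      using L by (simp only: mult_cancel_left) simp
    from arg_cong[OF this, of "\<lambda>p. poly p s"]
    have eq4: "poly U s * poly V s * of_real ((cmod (poly b s))\<^sup>2) =
        - (poly u2 s * poly v1 s * of_real ((cmod (poly a1 s))\<^sup>2))"
      unfolding complex_norm_square by (simp add: bsharp)
    \<comment> \<open>After both linear factors are cancelled, this multiple of the remaining
      identity has squared moduli with a minus sign on the right, but on the left two numbers with
      positive real part times a positive number.\<close>
    have "(poly U s * cnj (poly v1 s)) * (poly V s * cnj (poly u2 s)) * of_real ((cmod (poly b s))\<^sup>2)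
      = cnj (poly v1 s) * cnj (poly u2 s) * (poly U s * poly V s * of_real ((cmod (poly b s))\<^sup>2))"
      by (simp only: mult_ac)
    also have "\<dots> = - ((poly u2 s * cnj (poly u2 s)) * (poly v1 s * cnj (poly v1 s))
        * of_real ((cmod (poly a1 s))\<^sup>2))"
      unfolding eq4 by (simp only: mult_minus_right mult_ac)
    also have "\<dots> = - of_real ((cmod (poly u2 s))\<^sup>2 * (cmod (poly v1 s))\<^sup>2 * (cmod (poly a1 s))\<^sup>2)"
      unfolding complex_norm_square[symmetric] by simp
    finally show False
      by (rule Re_pos_mult_not_nonpos[OF U(2) V(2)]) (use bs in auto)
  qed
qed

lemma poly_constant_if_no_zero:
  assumes "\<And>s. poly p s \<noteq> (0::complex)"
  obtains c where "c \<noteq> 0" "p = [:c:]"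
proof -
  have "constant (poly p)" using assms fundamental_theorem_of_algebra by blast
  then have "degree p = 0" by (simp add: constant_degree)
  then obtain c where "p = [:c:]" by (rule degree_eq_zeroE)
  then show ?thesis using that[of c] assms[of 0] by simp
qed

lemma congruent_positive_imp_const:
  assumes f: "f \<in> Gplus_closure" and p: "p1 \<in> positive_funs" "p2 \<in> positive_funs" "p1 \<noteq> 0"
    and eq: "p1 = f * p2 * ratfun_sharp f"
  shows "\<exists>c. f = ratfun_const c"
proof -
  obtain a b where ab: "f = Fraction_Field.Fract a b" "a \<noteq> 0" "b \<noteq> 0"
    "\<And>s. poly a s \<noteq> 0 \<or> poly b s \<noteq> 0"
    "\<And>s. Re s < 0 \<Longrightarrow> poly a s \<noteq> 0" "\<And>s. Re s < 0 \<Longrightarrow> poly b s \<noteq> 0"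
    using Gplus_closureE[OF f] by metis
  obtain u1 v1 where p1: "p1 = Fraction_Field.Fract u1 v1" "v1 \<noteq> 0"
    "\<And>s. poly u1 s \<noteq> 0 \<or> poly v1 s \<noteq> 0"
    "\<And>s. Re s > 0 \<Longrightarrow> poly v1 s \<noteq> 0" "\<And>s. Re s \<ge> 0 \<Longrightarrow> pos_pair_at u1 v1 s"
    using positive_funsE[OF p(1)] by metis
  obtain u2 v2 where p2: "p2 = Fraction_Field.Fract u2 v2" "v2 \<noteq> 0"
    "\<And>s. poly u2 s \<noteq> 0 \<or> poly v2 s \<noteq> 0"
    "\<And>s. Re s > 0 \<Longrightarrow> poly v2 s \<noteq> 0" "\<And>s. Re s \<ge> 0 \<Longrightarrow> pos_pair_at u2 v2 s"
    using positive_funsE[OF p(2)] by metis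
  have u1: "u1 \<noteq> 0" using p(3) p1(1,2) by (auto simp: Zero_fract_def eq_fract)
  have "p2 \<noteq> 0" using p(3) eq by auto
  then have u2: "u2 \<noteq> 0" using p2(1,2) by (auto simp: Zero_fract_def eq_fract)
  have "Fraction_Field.Fract u1 v1 = Fraction_Field.Fract (a * u2 * poly_sharp a) (b * v2 * poly_sharp b)"
    using eq unfolding p1(1) p2(1) ab(1) ratfun_sharp_Fract[OF ab(3)] mult_fract .
  then have "u1 * (b * v2 * poly_sharp b) = a * u2 * poly_sharp a * v1"
    using p1(2) p2(2) ab(3) by (subst (asm) eq_fract(1)) simp_all
  then have E: "u1 * v2 * (b * poly_sharp b) = u2 * v1 * (a * poly_sharp a)"
    by (simp only: mult_ac)
  have "poly a s \<noteq> 0" for s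
    by (rule congruent_positive_no_zero[OF ab(5,6,4) u1 p1(4,5,3) p2(2,4,5,3) E])
  then obtain c where c: "c \<noteq> 0" "a = [:c:]" using poly_constant_if_no_zero by metis
  have "poly b s \<noteq> 0" for s
    using ab(4) by (intro congruent_positive_no_zero[OF ab(6,5) _ u2 p2(4,5,3) p1(2,4,5,3) E[symmetric]]) auto
  then obtain d where d: "d \<noteq> 0" "b = [:d:]" using poly_constant_if_no_zero by metis
  have "f = ratfun_const (c / d)"
    using d(1) unfolding ab(1) c(2) d(2) ratfun_const_def to_fract_def by (simp add: eq_fract)
  then show ?thesis ..
qed

text \<open>A common nonzero element makes the two positive functions congruent through
  \<open>g2 / g1\<close>, which again lies in \<open>Gplus_closure\<close> and is therefore
  constant.\<close>

lemma GP_of_inter: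
  assumes g1: "g1 \<in> Gplus_closure" and g2: "g2 \<in> Gplus_closure"
    and "\<nexists>c. g2 = ratfun_const c * g1"
  shows "GP_of g1 \<inter> GP_of g2 = {0}"
proof -
  have nz: "g1 \<noteq> 0" using g1 by (simp add: Gplus_closure_iff_num_den)
  have "\<psi> = 0" if \<psi>: "\<psi> \<in> GP_of g1" "\<psi> \<in> GP_of g2" for \<psi>
  proof (rule ccontr)
    assume "\<psi> \<noteq> 0"
    obtain p1 where p1: "p1 \<in> positive_funs" "\<psi> = g1 * p1 * ratfun_sharp g1"
      using \<psi>(1) by (auto simp: GP_of_def)
    obtain p2 where p2: "p2 \<in> positive_funs" "\<psi> = g2 * p2 * ratfun_sharp g2"
      using \<psi>(2) by (auto simp: GP_of_def)
    have "p1 \<noteq> 0" using \<open>\<psi> \<noteq> 0\<close> p1(2) by auto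
    have "p1 = \<psi> / (g1 * ratfun_sharp g1)" using p1(2) nz by simp
    also have "\<dots> = (g2 / g1) * p2 * ratfun_sharp (g2 / g1)"
      unfolding p2(2) ratfun_sharp_divide by simp
    finally obtain c where "g2 / g1 = ratfun_const c"
      using congruent_positive_imp_const[of "g2 / g1" p1 p2] p1(1) p2(1) \<open>p1 \<noteq> 0\<close>
        Gplus_closure_mult[OF g2 Gplus_closure_inverse[OF g1]] by (auto simp: divide_inverse)
    then have "g2 = ratfun_const c * g1" using nz by (simp add: divide_eq_eq)
    then show False using assms(3) by blast
  qed
  then show ?thesis using zero_in_GP_of by blast
qed

subsection \<open>Factorization of generalized positive functions\<close>

definition factorable :: "ratfun \<Rightarrow> bool" where
  "factorable \<psi> \<longleftrightarrow> (\<exists>g\<in>Gplus_closure. \<psi> \<in> GP_of g)"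

lemma factorable_congr:
  assumes "factorable \<psi>" "h \<in> Gplus_closure"
  shows "factorable (h * \<psi> * ratfun_sharp h)"
proof -
  obtain g where g: "g \<in> Gplus_closure" "\<psi> \<in> GP_of g"
    using assms(1) by (auto simp: factorable_def)
  then have "h * \<psi> * ratfun_sharp h \<in> GP_of (h * g)"
    unfolding ratfun_congr_GP_of[symmetric] ratfun_congr_def by blast
  then show ?thesis
    using Gplus_closure_mult[OF assms(2) g(1)] unfolding factorable_def by blast
qed

lemma factorable_positive:
  assumes "p \<in> positive_funs"
  shows "factorable p"
proof -
  have "(1::ratfun) \<in> Gplus_closure"
    unfolding One_fract_def by (rule Fract_in_Gplus_closure) simp_all
  moreover have "ratfun_sharp 1 = 1"
    unfolding One_fract_def
    by (simp add: ratfun_sharp_Fract poly_eq_poly_eq_iff[symmetric] fun_eq_iff poly_poly_sharp eq_fract)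
  then have "p = 1 * p * ratfun_sharp 1" by simp
  then have "p \<in> GP_of 1" using assms unfolding GP_of_def by blast
  ultimately show ?thesis unfolding factorable_def by blast
qed

text \<open>Congruence with \<open>h = s - a\<close> and with its inverse;
  \<open>Re a \<ge> 0\<close> puts \<open>h\<close> into \<open>Gplus_closure\<close>, and
  \<open>[:- cnj a, -1:]\<close> is the para-conjugate of the linear factor.\<close>

lemma factorable_linear_factor:
  assumes "factorable (Fraction_Field.Fract u v)" "v \<noteq> 0" "Re a \<ge> 0"
  shows "factorable (Fraction_Field.Fract ([:- a, 1:] * [:- cnj a, -1:] * u) v)" (is "factorable ?f")
    and "factorable (Fraction_Field.Fract u ([:- a, 1:] * [:- cnj a, -1:] * v))" (is "factorable ?g")
proof -
  define h where "h = Fraction_Field.Fract [:- a, 1:] 1"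
  have h: "h \<in> Gplus_closure"
    unfolding h_def using assms(3) by (intro Fract_in_Gplus_closure) auto
  have sh: "ratfun_sharp h = Fraction_Field.Fract [:- cnj a, -1:] 1"
    unfolding h_def by (simp add: ratfun_sharp_Fract poly_sharp_linear eq_fract)
      (simp add: poly_eq_poly_eq_iff[symmetric] fun_eq_iff poly_poly_sharp)
  have "h * Fraction_Field.Fract u v * ratfun_sharp h = ?f"
    unfolding sh unfolding h_def mult_fract by (simp only: mult_1_left mult_1_right mult_ac)
  then show "factorable ?f" using factorable_congr[OF assms(1) h] by simp
  have "inverse h * Fraction_Field.Fract u v * ratfun_sharp (inverse h) = ?g"
    unfolding ratfun_sharp_inverse sh
    unfolding h_def inverse_fract mult_fract by (simp only: mult_1_left mult_1_right mult_ac)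
  then show "factorable ?g"
    using factorable_congr[OF assms(1) Gplus_closure_inverse[OF h]] by simp
qed

text \<open>On the axis \<open>s - a\<close> is \<open>\<i>\<close> times a real number of either
  sign, so the sign condition bounds the imaginary part from both sides as \<open>s\<close>
  approaches \<open>a\<close>; \<open>d\<close> is the side.\<close>

lemma pos_pair_simple_zero_real:
  assumes "\<And>s. Re s = 0 \<Longrightarrow> pos_pair_at ([:- a, 1:] * u) v s" "Re a = 0"
  shows "Im (poly u a * cnj (poly v a)) = 0"
proof -
  have "d * Im (poly u a * cnj (poly v a)) \<le> 0" if "d\<^sup>2 = 1" for d :: real
  proof -
    define t where "t n = inverse (real (Suc n))" for n
    define g where "g n = a + of_real (d * t n) * \<i>" for n
    have tpos: "t n > 0" for n by (simp add: t_def)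
    have "g \<longlonglongrightarrow> a + of_real (d * 0) * \<i>"
      unfolding g_def t_def by (intro tendsto_intros LIMSEQ_inverse_real_of_nat)
    then have g: "g \<longlonglongrightarrow> a" by simp
    have "(\<lambda>n. d * Im (poly u (g n) * cnj (poly v (g n)))) \<longlonglongrightarrow> d * Im (poly u a * cnj (poly v a))"
      by (intro tendsto_intros g)
    moreover have "d * Im (poly u (g n) * cnj (poly v (g n))) \<le> 0" for n
    proof -
      have "pos_pair_at ([:- a, 1:] * u) v (g n)"
        using assms(2) by (intro assms(1)) (simp add: g_def)
      moreover have "poly ([:- a, 1:] * u) (g n) * cnj (poly v (g n)) =
          of_real (d * t n) * (\<i> * (poly u (g n) * cnj (poly v (g n))))"
      proof -
        have "poly [:- a, 1:] (g n) = of_real (d * t n) * \<i>" by (simp add: g_def)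
        then show ?thesis unfolding poly_mult by (simp only: mult_ac)
      qed
      ultimately have "(d * t n) * Re (\<i> * (poly u (g n) * cnj (poly v (g n)))) \<ge> 0"
        unfolding pos_pair_at_def by (metis Re_mult_of_real(1))
      then have "t n * (d * Im (poly u (g n) * cnj (poly v (g n)))) \<le> 0"
        unfolding Re_i_times by (simp only: mult_minus_right mult_ac)
      then show ?thesis using tpos[of n] by (simp only: mult_le_0_iff) linarith
    qed
    ultimately show ?thesis by (intro LIMSEQ_le_const2) auto
  qed
  from this[of 1] this[of "-1"] show ?thesis by simp
qed

lemma factorable_no_closed_right_pole:
  assumes "u \<noteq> 0" "\<And>s. Re s > 0 \<Longrightarrow> poly v s \<noteq> 0"
    and "\<And>s. Re s = 0 \<Longrightarrow> pos_pair_at u v s"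
    and "\<And>s. Re s = 0 \<Longrightarrow> poly v s = 0 \<Longrightarrow> simple_pos_zero v u s"
  shows "factorable (Fraction_Field.Fract u v)"
  using assms
proof (induction "degree u" arbitrary: u v rule: less_induct)
  case less
  note u = less.prems(1) and v = less.prems(2) and pos = less.prems(3) and pole = less.prems(4)
  have "v \<noteq> 0" using v[of 1] by auto
  have linear_sharp: "cnj (s - a) = - cnj a - s" if "Re s = 0" for s a
    using poly_linear_sharp[OF that, of a] by simp
  show ?case
  proof (cases "\<exists>a. Re a \<ge> 0 \<and> poly u a = 0 \<and> \<not> (Re a = 0 \<and> simple_pos_zero u v a)")
    case False
    have "Fraction_Field.Fract u v \<in> positive_funs"
    proof (rule positive_Fract)
      fix s :: complex assume s: "Re s > 0"
      show "poly v s \<noteq> 0" using v[OF s] .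
      show "pos_pair_at u v s"
      proof (rule pos_pair_half_plane[OF _ v _ pole pos s])
        show "poly u t \<noteq> 0" if "Re t > 0" for t
          using False that by (metis less_eq_real_def less_irrefl)
        show "simple_pos_zero u v t" if "Re t = 0" "poly u t = 0" for t
          using False that by (metis order_refl)
      qed
    qed
    then show ?thesis by (rule factorable_positive)
  next
    case True
    then obtain a where a: "Re a \<ge> 0" "poly u a = 0" "\<not> (Re a = 0 \<and> simple_pos_zero u v a)"
      by blast
    obtain u1 where u1: "u = [:- a, 1:] * u1" using a(2) by (auto simp: poly_eq_0_iff_dvd dvd_def)
    have "u1 \<noteq> 0" using u u1 by auto
    have deg: "degree u = Suc (degree u1)"
      unfolding u1 using \<open>u1 \<noteq> 0\<close> by (subst degree_mult_eq) auto
    have pu: "poly u s = (s - a) * poly u1 s" for s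
      unfolding u1 by (simp add: algebra_simps)
    have pole_a: "poly v a \<noteq> 0" if "Re a = 0"
      using pole[OF that] a(2) by (auto simp: simple_pos_zero_def)
    show ?thesis
    proof (cases "Re a = 0 \<and> poly u1 a = 0")
      \<comment> \<open>At a multiple imaginary zero, the square of \<open>s - a\<close> is minus
        the product of \<open>s - a\<close> and its para-conjugate. Hence two factors go at once and
        \<open>- u2\<close> remains, with the same sign on the axis.\<close>
      case True
      then obtain u2 where u2: "u1 = [:- a, 1:] * u2" by (auto simp: poly_eq_0_iff_dvd dvd_def)
      have ca: "- cnj a = a" using True by (intro minus_cnj_imaginary) simp
      have "u2 \<noteq> 0" using \<open>u1 \<noteq> 0\<close> u2 by auto
      then have "degree (- u2) < degree u"
        unfolding deg u2 by (subst degree_mult_eq) auto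
      have pu2: "cnj (poly u s) = of_real ((cmod (s - a))\<^sup>2) * cnj (poly (- u2) s)"
        "poly u s = of_real ((cmod (s - a))\<^sup>2) * poly (- u2) s" if "Re s = 0" for s
      proof -
        have pu1: "poly u1 s = (s - a) * poly u2 s"
          unfolding u2 by (simp add: algebra_simps)
        have cnj_diff: "cnj (s - a) = - (s - a)"
          using linear_sharp[OF that] ca by simp
        show "poly u s = of_real ((cmod (s - a))\<^sup>2) * poly (- u2) s"
          unfolding pu pu1 complex_norm_square cnj_diff poly_minus
          by (simp only: mult_minus_left mult_minus_right minus_minus mult_ac)
        then show "cnj (poly u s) = of_real ((cmod (s - a))\<^sup>2) * cnj (poly (- u2) s)"
          by simp
      qed
      have "factorable (Fraction_Field.Fract (- u2) v)"
      proof (rule less.hyps)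
        show "degree (- u2) < degree u" by fact
        show "- u2 \<noteq> 0" using \<open>u2 \<noteq> 0\<close> by simp
        show "\<And>s. Re s > 0 \<Longrightarrow> poly v s \<noteq> 0" by (rule v)
      next
        fix s :: complex assume s: "Re s = 0"
        show "pos_pair_at (- u2) v s"
        proof (rule pos_pair_at_cofinite[of "{a}", OF _ _ s])
          fix t assume t: "Re t = 0" "t \<notin> {a}"
          have "Re (of_real ((cmod (t - a))\<^sup>2) * (poly (- u2) t * cnj (poly v t))) \<ge> 0"
            using pos[OF t(1)] unfolding pos_pair_at_def pu2(2)[OF t(1)] by (simp only: mult.assoc)
          then have "(cmod (t - a))\<^sup>2 * Re (poly (- u2) t * cnj (poly v t)) \<ge> 0"
            by (simp only: Re_mult_of_real)
          then show "pos_pair_at (- u2) v t"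
            unfolding pos_pair_at_def using t(2) by (simp only: zero_le_mult_iff) auto
        qed simp
        assume "poly v s = 0"
        then obtain V where V: "v = [:- s, 1:] * V" "Re (poly V s * cnj (poly u s)) > 0"
          using pole[OF s] by (auto simp: simple_pos_zero_def)
        have "Re (of_real ((cmod (s - a))\<^sup>2) * (poly V s * cnj (poly (- u2) s))) > 0"
          using V(2) unfolding pu2(1)[OF s] by (simp only: mult_ac)
        then have "(cmod (s - a))\<^sup>2 * Re (poly V s * cnj (poly (- u2) s)) > 0"
          by (simp only: Re_mult_of_real)
        then have "Re (poly V s * cnj (poly (- u2) s)) > 0"
          by (simp only: zero_less_mult_iff) (auto simp: not_less[symmetric])
        then show "simple_pos_zero v (- u2) s"
          using V(1) unfolding simple_pos_zero_def by blast
      qed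
      from factorable_linear_factor(1)[OF this \<open>v \<noteq> 0\<close> a(1)]
      have "factorable (Fraction_Field.Fract ([:- a, 1:] * [:- cnj a, -1:] * - u2) v)" .
      moreover have "[:- cnj a, -1:] = - [:- a, 1:]" unfolding ca by simp
      then have "[:- a, 1:] * [:- cnj a, -1:] * - u2 = u"
        unfolding u1 u2 by (simp only: mult_minus_left mult_minus_right minus_minus mult_ac)
      ultimately show ?thesis by simp
    next
      case False
      \<comment> \<open>Moving \<open>s - a\<close> and its para-conjugate out of
        \<open>u / v\<close> leaves \<open>u1 / v1\<close>. For \<open>Re a > 0\<close> the new pole
        \<open>- cnj a\<close> lies in the left half plane; for imaginary \<open>a\<close> the zero
        turns into a pole at \<open>a\<close>.\<close>
      define v1 where "v1 = [:- cnj a, -1:] * v"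
      have pv1: "poly v1 s = (- cnj a - s) * poly v s" for s
        unfolding v1_def by (simp add: algebra_simps)
      have "factorable (Fraction_Field.Fract u1 v1)"
      proof (rule less.hyps)
        show "degree u1 < degree u" using deg by simp
        show "u1 \<noteq> 0" by fact
      next
        fix s :: complex assume s: "Re s > 0"
        have "Re (- cnj a - s) < 0" using s a(1) by simp
        then have "- cnj a - s \<noteq> 0" by (metis less_irrefl zero_complex.sel(1))
        then show "poly v1 s \<noteq> 0" unfolding pv1 using v[OF s] by simp
      next
        fix s :: complex assume s: "Re s = 0"
        have "cnj (- cnj a - s) = s - a" using linear_sharp[OF s, of a] by (metis complex_cnj_cnj)
        then have "poly u1 s * cnj (poly v1 s) = poly u s * cnj (poly v s)"
          unfolding pv1 pu complex_cnj_mult by (simp only: mult_ac)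
        then show "pos_pair_at u1 v1 s" using pos[OF s] unfolding pos_pair_at_def by simp
        assume "poly v1 s = 0"
        then consider "s = a" | "poly v s = 0" "s \<noteq> a"
          unfolding pv1 linear_sharp[OF s, symmetric] by auto
        then show "simple_pos_zero v1 u1 s"
        proof cases
          case 1
          then have Rea: "Re a = 0" using s by simp
          have ca: "- cnj a = a" using Rea by (rule minus_cnj_imaginary)
          let ?c = "poly u1 a * cnj (poly v a)"
          \<comment> \<open>The coefficient of the simple zero is real and nonzero, and it is not
            positive by the choice of \<open>a\<close>. It is thus negative, and the para-conjugate
            factor \<open>- (s - a)\<close> makes that of the new pole positive.\<close>
          have "Im ?c = 0"
            using pos Rea unfolding u1 by (rule pos_pair_simple_zero_real)
          moreover have "?c \<noteq> 0" using False Rea pole_a by simp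
          moreover have "\<not> Re ?c > 0" using a(3) Rea u1 unfolding simple_pos_zero_def by blast
          ultimately have "Re ?c < 0" by (auto simp: complex_eq_iff)
          then have "Re (poly (- v) a * cnj (poly u1 a)) > 0"
            by (simp add: mult.commute)
          moreover have "v1 = [:- a, 1:] * - v" unfolding v1_def ca by simp
          ultimately show ?thesis unfolding 1 simple_pos_zero_def by blast
        next
          case 2
          then obtain V where V: "v = [:- s, 1:] * V" "Re (poly V s * cnj (poly u s)) > 0"
            using pole[OF s] by (auto simp: simple_pos_zero_def)
          \<comment> \<open>At a pole \<open>s\<close> other than \<open>a\<close>, the factor lost
            by \<open>u\<close> reappears conjugated beside \<open>V\<close>, so the tested product
            is unchanged.\<close>
          have "poly ([:- cnj a, -1:] * V) s = cnj (s - a) * poly V s"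
            unfolding linear_sharp[OF s] by (simp add: algebra_simps)
          then have "poly ([:- cnj a, -1:] * V) s * cnj (poly u1 s) = poly V s * cnj (poly u s)"
            by (simp only: pu complex_cnj_mult mult_ac)
          then have "Re (poly ([:- cnj a, -1:] * V) s * cnj (poly u1 s)) > 0"
            using V(2) by (simp only:)
          moreover have "v1 = [:- s, 1:] * ([:- cnj a, -1:] * V)"
            unfolding v1_def V(1) by (simp only: mult_ac)
          ultimately show ?thesis unfolding simple_pos_zero_def by blast
        qed
      qed
      moreover have "v1 \<noteq> 0" using \<open>v \<noteq> 0\<close> unfolding v1_def mult_eq_0_iff by simp
      ultimately have "factorable (Fraction_Field.Fract ([:- a, 1:] * [:- cnj a, -1:] * u1) v1)"
        using a(1) by (intro factorable_linear_factor)
      moreover have "Fraction_Field.Fract ([:- a, 1:] * [:- cnj a, -1:] * u1) v1 = Fraction_Field.Fract u v"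
        unfolding eq_fract(1)[OF \<open>v1 \<noteq> 0\<close> \<open>v \<noteq> 0\<close>] unfolding u1 v1_def by (simp only: mult_ac)
      ultimately show ?thesis by simp
    qed
  qed
qed

text \<open>Induction on the degree of the denominator: each pole \<open>b\<close> in the closed
  right half plane is removed by a congruence with \<open>1 / (s - b)\<close>, which puts the
  para-conjugate factor into the numerator. This ends when no such pole is left.\<close>

lemma factorable_Fract:
  assumes "u \<noteq> 0" "v \<noteq> 0" "\<And>s. Re s = 0 \<Longrightarrow> pos_pair_at u v s"
  shows "factorable (Fraction_Field.Fract u v)"
  using assms
proof (induction "degree v" arbitrary: u v rule: less_induct)
  case less
  note u = less.prems(1) and v = less.prems(2) and pos = less.prems(3)
  show ?case
  proof (cases "\<exists>b. Re b \<ge> 0 \<and> poly v b = 0")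
    case False
    have "poly v s \<noteq> 0" if "Re s \<ge> 0" for s using False that by blast
    then show ?thesis
      using u pos by (intro factorable_no_closed_right_pole) auto
  next
    case True
    then obtain b where b: "Re b \<ge> 0" "poly v b = 0" by blast
    obtain v1 where v1: "v = [:- b, 1:] * v1" using b(2) by (auto simp: poly_eq_0_iff_dvd dvd_def)
    have "v1 \<noteq> 0" using v v1 by auto
    define u1 where "u1 = [:- cnj b, -1:] * u"
    have "factorable (Fraction_Field.Fract u1 v1)"
    proof (rule less.hyps)
      show "degree v1 < degree v"
        unfolding v1 using \<open>v1 \<noteq> 0\<close> by (subst degree_mult_eq) auto
      show "u1 \<noteq> 0" using u unfolding u1_def mult_eq_0_iff by simp
      show "v1 \<noteq> 0" by fact
      fix s :: complex assume s: "Re s = 0"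
      have "poly u1 s * cnj (poly v1 s) = poly u s * cnj (poly v s)"
        unfolding u1_def v1 poly_mult complex_cnj_mult poly_linear_sharp[OF s] by (simp only: mult_ac)
      then show "pos_pair_at u1 v1 s" using pos[OF s] unfolding pos_pair_at_def by simp
    qed
    from factorable_linear_factor(2)[OF this \<open>v1 \<noteq> 0\<close> b(1)]
    have "factorable (Fraction_Field.Fract u1 ([:- b, 1:] * [:- cnj b, -1:] * v1))" .
    moreover have nz: "[:- b, 1:] * [:- cnj b, -1:] * v1 \<noteq> 0"
      using \<open>v1 \<noteq> 0\<close> unfolding mult_eq_0_iff by simp
    have "Fraction_Field.Fract u1 ([:- b, 1:] * [:- cnj b, -1:] * v1) = Fraction_Field.Fract u v"
      unfolding eq_fract(1)[OF nz v] unfolding u1_def v1 by (simp only: mult_ac)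
    ultimately show ?thesis by simp
  qed
qed

lemma gen_positive_eq_Union: "gen_positive_funs = (\<Union>g\<in>Gplus_closure. GP_of g)"
proof (intro equalityI subsetI)
  fix \<psi> assume \<psi>: "\<psi> \<in> gen_positive_funs"
  have "factorable \<psi>"
  proof (cases "\<psi> = 0")
    case True
    then show ?thesis using factorable_positive[OF zero_in_positive_funs] by simp
  next
    case False
    then have "factorable (Fraction_Field.Fract (num \<psi>) (den \<psi>))"
      using \<psi> by (intro factorable_Fract) (auto simp: gen_positive_iff_num_den)
    then show ?thesis by simp
  qed
  then show "\<psi> \<in> (\<Union>g\<in>Gplus_closure. GP_of g)" by (auto simp: factorable_def)
qed (use GP_of_subset_gen_positive in blast)

theorem mainTheorem2:
  shows
    "(\<forall>g\<in>Gplus_closure. GP_of g \<subseteq> gen_positive_funs \<and> convex_cone (GP_of g)) \<and>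
     (\<forall>g1\<in>Gplus_closure. \<forall>g2\<in>Gplus_closure.
        GP_of g2 = ratfun_congr (g2 / g1) (GP_of g1)) \<and>
     (\<forall>g1\<in>Gplus_closure. \<forall>g2\<in>Gplus_closure.
        (\<nexists>c. g2 = ratfun_const c * g1) \<longrightarrow> GP_of g1 \<inter> GP_of g2 = {0}) \<and>
     gen_positive_funs = (\<Union>g\<in>Gplus_closure. GP_of g) \<and>
     (\<forall>g\<in>Gplus_closure.
        ratfun_set_inverse (GP_of g) = GP_of (inverse (ratfun_sharp g)) - {0})"
proof (intro conjI ballI impI)
  fix g assume g: "g \<in> Gplus_closure"
  show "GP_of g \<subseteq> gen_positive_funs" by (rule GP_of_subset_gen_positive)
  show "convex_cone (GP_of g)" by (rule convex_cone_GP_of)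
  have "g \<noteq> 0" using g by (simp add: Gplus_closure_iff_num_den)
  then show "ratfun_set_inverse (GP_of g) = GP_of (inverse (ratfun_sharp g)) - {0}"
    by (rule GP_of_inverse)
next
  fix g1 g2 assume "g1 \<in> Gplus_closure" "g2 \<in> Gplus_closure"
  then have "g1 \<noteq> 0" by (simp add: Gplus_closure_iff_num_den)
  then show "GP_of g2 = ratfun_congr (g2 / g1) (GP_of g1)"
    by (simp add: ratfun_congr_GP_of)
next
  fix g1 g2 assume "g1 \<in> Gplus_closure" "g2 \<in> Gplus_closure" "\<nexists>c. g2 = ratfun_const c * g1"
  then show "GP_of g1 \<inter> GP_of g2 = {0}" by (rule GP_of_inter)
next
  show "gen_positive_funs = (\<Union>g\<in>Gplus_closure. GP_of g)" by (rule gen_positive_eq_Union)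
qed

end
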